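(* For $p>1$ let $u_p$ be the positive solution of $-u''=u^p$ in $I=(-1,1)$, $u>0$ in $I$, $u(\pm1)=0$, let $\alpha_1(p)$ be the first eigenvalue of $L_{u_p}=-\frac{d^2}{dt^2}-p\,u_p^{p-1}$ in $I$ with Dirichlet boundary conditions, and let $\varphi_1(t)=\cos\left(\frac\pi2 t\right)$, $t\in\bar I=[-1,1]$, be the first eigenfunction of $-\frac{d^2}{dt^2}$ in $I$ with Dirichlet boundary conditions. Then: (1) $\|u_p\|_\infty^{p-1}=\frac{\pi^2}{4}+\frac{\pi^2}{4}\,\tilde c\,(p-1)+o(p-1)$ as $p\to1$, where $\tilde c=\dfrac{\int_{-1}^1\varphi_1^2(t)\,|\log(\varphi_1(t))|\,dt}{\int_{-1}^1\varphi_1^2(t)\,dt}>0$; (2) $\lim_{p\to1}\dfrac{u_p}{\|u_p\|_\infty}=\varphi_1$ in $C^1(\bar I)$; (3) $p\,u_p^{p-1}\to\frac{\pi^2}{4}$ in $C^1_{loc}(I)$ as $p\to1$; (4) $\lim_{p\to1}\alpha_1(p)=0$.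
   Context: For every $p>1$ the boundary value problem has a unique positive solution $u_p$; it is even and decreasing on $[0,1]$, so $\|u_p\|_\infty=u_p(0)$. All limits $p\to1$ are taken with $p>1$. Convergence in $C^1_{loc}(I)$ means $C^1$ convergence on every compact subset of the open interval $I$. *)

theory Defs
  imports "HOL-Analysis.Analysis" "HOL-Library.Landau_Symbols"
begin

text \<open>
  Classical Dirichlet problem on the interval from -1 to 1: \<open>v\<close> is continuous on the closed
  interval, vanishes at both end points, and is twice differentiable in the open interval with
  \<open>- v'' = f\<close>.  For the continuous right-hand sides used below, \<open>v\<close> is then automatically
  of class \<open>C^2\<close> in the open interval.  The values of \<open>v\<close> outside the closed interval are irrelevant.
\<close>

definition dirichlet_solution :: "(real \<Rightarrow> real) \<Rightarrow> (real \<Rightarrow> real) \<Rightarrow> bool" where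
  "dirichlet_solution f v \<longleftrightarrow>
     continuous_on {-1..1} v \<and> v (-1) = 0 \<and> v 1 = 0 \<and>
     (\<exists>v'. \<forall>t\<in>{-1<..<1}. (v has_real_derivative v' t) (at t) \<and>
                          (v' has_real_derivative - f t) (at t))"

definition positive_solution :: "real \<Rightarrow> (real \<Rightarrow> real) \<Rightarrow> bool" where
  "positive_solution p u \<longleftrightarrow>
     dirichlet_solution (\<lambda>t. u t powr p) u \<and> (\<forall>t\<in>{-1<..<1}. u t > 0)"

text \<open>
  Dirichlet eigenvalues of the operator \<open>\<phi> \<mapsto> - \<phi>'' - q \<phi>\<close>; the eigenvalue equation is
  \<open>- \<phi>'' = q \<phi> + lam \<phi>\<close>.
\<close>

definition dirichlet_eigenvalue :: "(real \<Rightarrow> real) \<Rightarrow> real \<Rightarrow> bool" where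
  "dirichlet_eigenvalue q lam \<longleftrightarrow>
     (\<exists>\<phi>. dirichlet_solution (\<lambda>t. q t * \<phi> t + lam * \<phi> t) \<phi> \<and> (\<exists>t\<in>{-1<..<1}. \<phi> t \<noteq> 0))"

definition first_dirichlet_eigenvalue :: "(real \<Rightarrow> real) \<Rightarrow> real \<Rightarrow> bool" where
  "first_dirichlet_eigenvalue q lam \<longleftrightarrow>
     dirichlet_eigenvalue q lam \<and> (\<forall>\<mu>. dirichlet_eigenvalue q \<mu> \<longrightarrow> lam \<le> \<mu>)"

definition sup_norm :: "(real \<Rightarrow> real) \<Rightarrow> real" where
  "sup_norm v = (SUP t\<in>{-1..1}. \<bar>v t\<bar>)"

definition phi1 :: "real \<Rightarrow> real" where
  "phi1 t = cos (pi / 2 * t)"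

text \<open>The integrand has limit 0 at the end points, where \<open>ln (phi1 t)\<close> is \<open>ln 0 = 0\<close> in HOL.\<close>

definition c_tilde :: real where
  "c_tilde = integral {-1..1} (\<lambda>t. (phi1 t)\<^sup>2 * \<bar>ln (phi1 t)\<bar>) / integral {-1..1} (\<lambda>t. (phi1 t)\<^sup>2)"

text \<open>
  Derivatives are taken within \<open>S\<close>, hence are one-sided at the end points of a closed interval and
  two-sided in an open one.  For nondegenerate intervals \<open>S\<close> the derivative is unique.
\<close>

definition C1_deriv_on :: "real set \<Rightarrow> (real \<Rightarrow> real) \<Rightarrow> (real \<Rightarrow> real) \<Rightarrow> bool" where
  "C1_deriv_on S g g' \<longleftrightarrow>
     continuous_on S g' \<and> (\<forall>t\<in>S. (g has_real_derivative g' t) (at t within S))"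

definition C1_limit :: "real set \<Rightarrow> ('i \<Rightarrow> real \<Rightarrow> real) \<Rightarrow> (real \<Rightarrow> real) \<Rightarrow> 'i filter \<Rightarrow> bool" where
  "C1_limit S f g F \<longleftrightarrow>
     (\<exists>f' g'. (\<forall>\<^sub>F i in F. C1_deriv_on S (f i) (f' i)) \<and> C1_deriv_on S g g' \<and>
        uniform_limit S f g F \<and> uniform_limit S f' g' F)"

definition C1_loc_limit :: "real set \<Rightarrow> ('i \<Rightarrow> real \<Rightarrow> real) \<Rightarrow> (real \<Rightarrow> real) \<Rightarrow> 'i filter \<Rightarrow> bool" where
  "C1_loc_limit S f g F \<longleftrightarrow>
     (\<exists>f' g'. (\<forall>\<^sub>F i in F. C1_deriv_on S (f i) (f' i)) \<and> C1_deriv_on S g g' \<and>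
        (\<forall>K. compact K \<and> K \<subseteq> S \<longrightarrow> uniform_limit K f g F \<and> uniform_limit K f' g' F))"

end

theory Submission imports Defs begin

text \<open>
  Let \<open>v = u / M\<close> with \<open>M\<close> the maximum of \<open>u\<close> and \<open>lam = M powr (p - 1)\<close>, so that
  \<open>- v'' = lam * v powr p\<close> and \<open>max v = 1\<close>.  Testing with \<open>phi1\<close> gives
  \<open>(lam - pi\<^sup>2 / 4) \<integral> v powr p * phi1 = pi\<^sup>2 / 4 \<integral> (v - v powr p) * phi1\<close>.  Concavity bounds
  the left integral from below and \<open>v - v powr p \<le> p - 1\<close> bounds the right one from above, hence
  \<open>lam - pi\<^sup>2 / 4 = O(p - 1)\<close>.  So \<open>v\<close> solves \<open>v'' + pi\<^sup>2 / 4 * v = O(p - 1)\<close>, and variation of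
  constants yields \<open>v = phi1 + O(p - 1)\<close> together with first derivatives.  Dividing the identity
  by \<open>p - 1\<close> and using \<open>(v - v powr p) / (p - 1) \<longlongrightarrow> - phi1 * ln phi1\<close> gives the expansion of \<open>lam\<close>.

  Every eigenvalue is at least \<open>pi\<^sup>2 / 4 - p * lam\<close>, because the potential is at most \<open>p * lam\<close>.
  Some eigenvalue is at most 0, by shooting from the left end point: for the spectral
  parameter 0 the solution is explicit and negative at 1, for very negative parameters it is
  positive, and it depends continuously on the parameter.
\<close>

section \<open>Second-order ordinary differential equations\<close>

text \<open>The definition gives derivatives only in the open interval. There the derivative of
  \<open>v\<close> differs from a primitive of \<open>- f\<close> by a constant, so it extends
  continuously to the end points. Since \<open>v\<close> itself is continuous up to the ends, it
  equals a primitive of this extension up to a constant. One-sided derivatives at the ends are what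
  Green's identity and the end slopes rely on later.\<close>

lemma dirichlet_solution_C2:
  assumes sol: "dirichlet_solution f v" and contf: "continuous_on {-1..1} f"
  obtains v' where "\<And>t. t \<in> {-1..1} \<Longrightarrow> (v has_real_derivative v' t) (at t within {-1..1})"
    "\<And>t. t \<in> {-1..1} \<Longrightarrow> (v' has_real_derivative - f t) (at t within {-1..1})"
proof -
  obtain w where contv: "continuous_on {-1..1} v"
    and dw: "\<forall>t\<in>{-1<..<1}. (v has_real_derivative w t) (at t) \<and> (w has_real_derivative - f t) (at t)"
    using sol unfolding dirichlet_solution_def by (elim conjE exE)
  have w: "(v has_real_derivative w t) (at t)" and w': "(w has_real_derivative - f t) (at t)"
    if "t \<in> {-1<..<1}" for t
    using dw that by auto
  have at: "at t within {-1..1} = at t" if "t \<in> {-1<..<1}" for t :: real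
    using that by (simp add: at_within_Icc_at)
  define g where "g = (\<lambda>t. integral {-1..t} (\<lambda>s. - f s))"
  have g: "(g has_real_derivative - f t) (at t within {-1..1})" if "t \<in> {-1..1}" for t
    unfolding g_def using that contf
    by (intro integral_has_real_derivative continuous_intros) auto
  have "((\<lambda>t. w t - g t) has_real_derivative 0) (at t within {-1<..<1})"
    if "t \<in> {-1<..<1}" for t
  proof -
    have "((\<lambda>t. w t - g t) has_real_derivative 0) (at t)"
      using w'[OF that] g[of t] at[OF that] that by (auto intro!: derivative_eq_intros)
    then show ?thesis
      by (rule has_field_derivative_at_within)
  qed
  then obtain c where c: "\<And>t. t \<in> {-1<..<1} \<Longrightarrow> w t - g t = c"
    using has_field_derivative_zero_constant[of "{-1<..<1::real}" "\<lambda>t. w t - g t"] by auto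
  \<comment> \<open>The values of \<open>w\<close> at the end points are arbitrary, so the
    derivative is rebuilt from \<open>g\<close>, which is defined on the closed interval.\<close>
  define v' where "v' = (\<lambda>t. c + g t)"
  have v': "(v' has_real_derivative - f t) (at t within {-1..1})" if "t \<in> {-1..1}" for t
    unfolding v'_def using g[OF that] by (auto intro!: derivative_eq_intros)
  then have contv': "continuous_on {-1..1} v'"
    by (rule DERIV_continuous_on)
  define V where "V = (\<lambda>t. integral {-1..t} v')"
  have V: "(V has_real_derivative v' t) (at t within {-1..1})" if "t \<in> {-1..1}" for t
    unfolding V_def using that contv' by (intro integral_has_real_derivative) auto
  have "continuous_on {-1..1} (\<lambda>t. v t - V t)"
    using contv DERIV_continuous_on[OF V] by (intro continuous_intros) auto
  moreover have "((\<lambda>t. v t - V t) has_real_derivative 0) (at t)" if "-1 < t" "t < 1" for t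
    using w[of t] c[of t] V[of t] at[of t] that unfolding v'_def
    by (auto intro!: derivative_eq_intros)
  ultimately have "v t - V t = v (-1) - V (-1)" if "t \<in> {-1..1}" for t
    using that DERIV_isconst2[of "-1" 1 "\<lambda>t. v t - V t" t] by auto
  then have vV: "v t = V t + (v (-1) - V (-1))" if "t \<in> {-1..1}" for t
    using that by (metis add.commute diff_eq_eq)
  have "(v has_real_derivative v' t) (at t within {-1..1})" if t: "t \<in> {-1..1}" for t
  proof (rule has_field_derivative_transform_within[OF _ zero_less_one t])
    show "((\<lambda>t. V t + (v (-1) - V (-1))) has_real_derivative v' t) (at t within {-1..1})"
      using V[OF t] by (auto intro!: derivative_eq_intros)
  qed (rule vV[symmetric])
  with v' show ?thesis
    using that by blast
qed

text \<open>Picard iteration for the pair of solution and derivative, written as a series: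
  \<open>y n\<close> and \<open>z n\<close> are the successive increments. They are bounded by
  \<open>D * K ^ n * (t - a) ^ n / fact n\<close>, so the Weierstrass test permits termwise
  differentiation of both series.\<close>

lemma linear_ivp_exists:
  fixes b :: "real \<Rightarrow> real"
  assumes ac: "a \<le> c" and contb: "continuous_on {a..c} b"
  obtains f f' where "f a = A" "f' a = B"
    "\<And>t. t \<in> {a..c} \<Longrightarrow> (f has_real_derivative f' t) (at t within {a..c})"
    "\<And>t. t \<in> {a..c} \<Longrightarrow> (f' has_real_derivative b t * f t) (at t within {a..c})"
proof -
  \<comment> \<open>\<open>step\<close> sends one increment to the next. The increment of index 0
    carries the initial data, and all later ones vanish at \<open>a\<close>.\<close>
  define step where "step = (\<lambda>(y, z :: real \<Rightarrow> real). (\<lambda>t. integral {a..t} (\<lambda>s. integral {a..s} (\<lambda>r. b r * y r)),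
      \<lambda>t. integral {a..t} (\<lambda>r. b r * (y r :: real))) :: (real \<Rightarrow> real) \<times> (real \<Rightarrow> real))"
  define yz where "yz = (\<lambda>n. (step ^^ n) (\<lambda>t. A + B * (t - a), \<lambda>t. B))"
  define y z where "y = (\<lambda>n. fst (yz n))" and "z = (\<lambda>n. snd (yz n))"
  have y0: "y 0 = (\<lambda>t. A + B * (t - a))" and z0: "z 0 = (\<lambda>t. B)"
    by (simp_all add: y_def z_def yz_def)
  have zS: "z (Suc n) = (\<lambda>t. integral {a..t} (\<lambda>r. b r * y n r))"
    and yS: "y (Suc n) = (\<lambda>t. integral {a..t} (z (Suc n)))" for n
    by (simp_all add: y_def z_def yz_def step_def split: prod.splits)
  have contyz: "continuous_on {a..c} (y n) \<and> continuous_on {a..c} (z n)" for n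
    proof (induction n)
      case 0
      show ?case unfolding y0 z0 by (intro conjI continuous_intros)
    next
      case (Suc n)
      have "((\<lambda>t. z (Suc n) t) has_real_derivative b t * y n t) (at t within {a..c})"
        if "t \<in> {a..c}" for t
        unfolding zS using that Suc contb
        by (intro integral_has_real_derivative continuous_intros) auto
      then have z: "continuous_on {a..c} (z (Suc n))"
        by (rule DERIV_continuous_on)
      then have "((\<lambda>t. y (Suc n) t) has_real_derivative z (Suc n) t) (at t within {a..c})"
        if "t \<in> {a..c}" for t
        unfolding yS using that by (intro integral_has_real_derivative) auto
      then have "continuous_on {a..c} (y (Suc n))"
        by (rule DERIV_continuous_on)
      with z show ?case by blast
    qed
  note conty = conjunct1[OF contyz] and contz = conjunct2[OF contyz]
  have dz: "(z (Suc n) has_real_derivative b t * y n t) (at t within {a..c})"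
    if "t \<in> {a..c}" for t n
    unfolding zS using that conty[of n] contb
    by (intro integral_has_real_derivative continuous_intros) auto
  have dy: "(y n has_real_derivative z n t) (at t within {a..c})" if "t \<in> {a..c}" for t n
  proof (cases n)
    case 0
    then show ?thesis
      unfolding 0 y0 z0 by (auto intro!: derivative_eq_intros)
  next
    case (Suc m)
    show ?thesis
      unfolding Suc yS using that contz[of "Suc m"] by (intro integral_has_real_derivative) auto
  qed
  have "bounded (b ` {a..c})"
    using compact_continuous_image[OF contb] compact_imp_bounded by blast
  then obtain C where C: "C > 0" "\<And>t. t \<in> {a..c} \<Longrightarrow> \<bar>b t\<bar> \<le> C"
    unfolding bounded_pos by auto
  define K where "K = C * (1 + (c - a))"
  define D where "D = \<bar>A\<bar> + \<bar>B\<bar> * (1 + (c - a))"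
  have "C * (c - a) \<ge> 0"
    using C ac by simp
  then have K: "C \<le> K" "C * (c - a) \<le> K"
    using C by (simp_all add: K_def distrib_left)
  have D: "D \<ge> 0"
    unfolding D_def using ac by (intro add_nonneg_nonneg mult_nonneg_nonneg) auto
  have pow: "((\<lambda>s. s0 * (s - a) ^ n / fact n) has_integral s0 * (t - a) ^ Suc n / fact (Suc n)) {a..t}"
    if "t \<in> {a..c}" for t s0 n
  proof -
    have "((\<lambda>s. s0 * (s - a) ^ n / fact n) has_integral
      s0 * (t - a) ^ Suc n / fact (Suc n) - s0 * (a - a) ^ Suc n / fact (Suc n)) {a..t}"
      using that
      by (intro fundamental_theorem_of_calculus)
        (auto simp flip: has_real_derivative_iff_has_vector_derivative
          intro!: derivative_eq_intros simp: divide_simps simp del: power_Suc)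
    then show ?thesis by simp
  qed
  have bound: "\<bar>y n t\<bar> \<le> D * K ^ n * (t - a) ^ n / fact n \<and> \<bar>z n t\<bar> \<le> D * K ^ n * (t - a) ^ n / fact n"
    if "t \<in> {a..c}" for t n
    using that
  proof (induction n arbitrary: t)
    case 0
    have "\<bar>A + B * (t - a)\<bar> \<le> \<bar>A\<bar> + \<bar>B\<bar> * (t - a)"
      using 0 abs_triangle_ineq[of A "B * (t - a)"] by (simp add: abs_mult)
    also have "\<dots> \<le> D"
      using 0 unfolding D_def by (intro add_mono mult_left_mono) auto
    finally have "\<bar>A + B * (t - a)\<bar> \<le> D" .
    moreover have "\<bar>B\<bar> * (c - a) \<ge> 0"
      using ac by simp
    then have "\<bar>B\<bar> \<le> D"
      by (simp add: D_def distrib_left)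
    ultimately show ?case
      by (simp add: y0 z0)
  next
    case (Suc n)
    have sub: "{a..s} \<subseteq> {a..c}" if "s \<in> {a..c}" for s using that by auto
    have zb: "\<bar>z (Suc n) s\<bar> \<le> C * D * K ^ n * (s - a) ^ Suc n / fact (Suc n)"
      if s: "s \<in> {a..c}" for s
    proof -
      have "norm (integral {a..s} (\<lambda>r. b r * y n r))
          \<le> integral {a..s} (\<lambda>r. C * D * K ^ n * (r - a) ^ n / fact n)"
      proof (rule integral_norm_bound_integral)
        show "(\<lambda>r. b r * y n r) integrable_on {a..s}"
          using contb conty[of n] sub[OF s]
          by (intro integrable_continuous_real continuous_intros)
            (auto intro: continuous_on_subset)
        show "(\<lambda>r. C * D * K ^ n * (r - a) ^ n / fact n) integrable_on {a..s}"
          using pow[OF s] by blast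
        show "norm (b r * y n r) \<le> C * D * K ^ n * (r - a) ^ n / fact n" if "r \<in> {a..s}" for r
          using mult_mono[OF C(2) conjunct1[OF Suc.IH], of r r] that s C(1)
          by (auto simp: abs_mult mult.assoc)
      qed
      then show ?thesis
        unfolding zS integral_unique[OF pow[OF s]] by simp
    qed
    \<comment> \<open>The integrand is bounded by its value at the right end point. The second
      integration then contributes a plain factor \<open>t - a\<close>, absorbed in
      \<open>K\<close>, and the power stays at \<open>Suc n\<close> for both components.\<close>
    have "norm (integral {a..t} (z (Suc n)))
        \<le> integral {a..t} (\<lambda>r. C * D * K ^ n * (t - a) ^ Suc n / fact (Suc n))"
    proof (rule integral_norm_bound_integral)
      show "z (Suc n) integrable_on {a..t}"
        using contz[of "Suc n"] sub[OF Suc.prems]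
        by (intro integrable_continuous_real) (auto intro: continuous_on_subset)
      fix r assume r: "r \<in> {a..t}"
      have "\<bar>z (Suc n) r\<bar> \<le> C * D * K ^ n * (r - a) ^ Suc n / fact (Suc n)"
        using zb[of r] r Suc.prems by auto
      also have "\<dots> \<le> C * D * K ^ n * (t - a) ^ Suc n / fact (Suc n)"
        using r C D K by (intro divide_right_mono mult_left_mono power_mono) auto
      finally show "norm (z (Suc n) r) \<le> C * D * K ^ n * (t - a) ^ Suc n / fact (Suc n)"
        by simp
    qed auto
    also have "\<dots> = (C * (t - a)) * (D * K ^ n * (t - a) ^ Suc n / fact (Suc n))"
      using Suc.prems by simp
    also have "\<dots> \<le> K * (D * K ^ n * (t - a) ^ Suc n / fact (Suc n))"
    proof (rule mult_right_mono)
      have "C * (t - a) \<le> C * (c - a)" using Suc.prems C by auto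
      then show "C * (t - a) \<le> K" using K by simp
    qed (use Suc.prems C D K in auto)
    finally have "\<bar>y (Suc n) t\<bar> \<le> D * K ^ Suc n * (t - a) ^ Suc n / fact (Suc n)"
      by (simp add: yS mult_ac)
    moreover have "C * (D * K ^ n * (t - a) ^ Suc n / fact (Suc n))
        \<le> K * (D * K ^ n * (t - a) ^ Suc n / fact (Suc n))"
      using Suc.prems C D K by (intro mult_right_mono) auto
    then have "\<bar>z (Suc n) t\<bar> \<le> D * K ^ Suc n * (t - a) ^ Suc n / fact (Suc n)"
      using zb[OF Suc.prems] by (simp add: mult_ac)
    ultimately show ?case ..
  qed
  define M where "M = (\<lambda>n. D * (inverse (fact n) * (K * (c - a)) ^ n))"
  have M: "summable M"
    unfolding M_def by (intro summable_mult summable_exp)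
  have yM: "norm (y n t) \<le> M n" and zM: "norm (z n t) \<le> M n" if "t \<in> {a..c}" for n t
  proof -
    have "D * K ^ n * (t - a) ^ n / fact n \<le> D * K ^ n * (c - a) ^ n / fact n"
      using that C D K by (intro divide_right_mono mult_left_mono power_mono) auto
    also have "\<dots> = M n"
      by (simp add: M_def power_mult_distrib divide_inverse mult_ac)
    finally show "norm (y n t) \<le> M n" "norm (z n t) \<le> M n"
      using bound[OF that, of n] by auto
  qed
  define f f' where "f = (\<lambda>t. \<Sum>n. y n t)" and "f' = (\<lambda>t. \<Sum>n. z n t)"
  have sumy: "summable (\<lambda>n. y n t)" and sumz: "summable (\<lambda>n. z n t)" if "t \<in> {a..c}" for t
    using summable_comparison_test'[OF M, of 0 "\<lambda>n. y n t"] yM[OF that]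
      summable_comparison_test'[OF M, of 0 "\<lambda>n. z n t"] zM[OF that] by simp_all
  \<comment> \<open>The derivative of \<open>z n\<close> involves \<open>y (n - 1)\<close>, and the
    term of index 0 vanishes. The series of derivatives is therefore the series of
    \<open>b t * y n t\<close> shifted by one index, with the same uniform limit.\<close>
  have dz': "(z n has_real_derivative (case n of 0 \<Rightarrow> 0 | Suc m \<Rightarrow> b t * y m t)) (at t within {a..c})"
    if "t \<in> {a..c}" for t n
    using dz[OF that] by (cases n) (auto simp: z0)
  have "uniform_limit {a..c} (\<lambda>n t. \<Sum>i<n. z i t) f' sequentially"
    unfolding f'_def using M zM by (intro Weierstrass_m_test)
  then have "\<exists>g. \<forall>t\<in>{a..c}. (\<lambda>n. y n t) sums g t \<and> (g has_real_derivative f' t) (at t within {a..c})"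
    using dy sumy[of a] ac by (intro has_field_derivative_series[where ?x0.0 = a]) auto
  then obtain g where g: "\<And>t. t \<in> {a..c} \<Longrightarrow> (\<lambda>n. y n t) sums g t \<and>
      (g has_real_derivative f' t) (at t within {a..c})"
    by blast
  have gf: "g t = f t" if "t \<in> {a..c}" for t
    using g[OF that] unfolding f_def by (simp add: sums_iff)
  have df: "(f has_real_derivative f' t) (at t within {a..c})" if "t \<in> {a..c}" for t
    using has_field_derivative_transform_within[OF conjunct2[OF g[OF that]] zero_less_one that] gf by blast
  have "uniform_limit {a..c} (\<lambda>n t. \<Sum>i<n. y i t) f sequentially"
    unfolding f_def using M yM by (intro Weierstrass_m_test)
  then have "uniform_limit {a..c} (\<lambda>n t. b t * (\<Sum>i<n. y i t)) (\<lambda>t. b t * f t) sequentially"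
    using compact_continuous_image[OF contb] 
      compact_continuous_image[OF DERIV_continuous_on[OF df]]
    by (intro uniform_lim_mult uniform_limit_const) (auto intro: compact_imp_bounded)
  then have "uniform_limit {a..c} (\<lambda>n t. \<Sum>i<Suc n. case i of 0 \<Rightarrow> 0 | Suc m \<Rightarrow> b t * y m t)
      (\<lambda>t. b t * f t) sequentially"
    by (simp add: sum.lessThan_Suc_shift sum_distrib_left del: sum.lessThan_Suc)
  then have "uniform_limit {a..c} (\<lambda>n t. \<Sum>i<n. case i of 0 \<Rightarrow> 0 | Suc m \<Rightarrow> b t * y m t)
      (\<lambda>t. b t * f t) sequentially"
    by (subst (asm) filterlim_sequentially_Suc)
  then have "\<exists>g. \<forall>t\<in>{a..c}. (\<lambda>n. z n t) sums g t \<and> (g has_real_derivative b t * f t) (at t within {a..c})"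
    using dz' sumz[of a] ac by (intro has_field_derivative_series[where ?x0.0 = a]) auto
  then obtain g' where g': "\<And>t. t \<in> {a..c} \<Longrightarrow> (\<lambda>n. z n t) sums g' t \<and>
      (g' has_real_derivative b t * f t) (at t within {a..c})"
    by blast
  have gf': "g' t = f' t" if "t \<in> {a..c}" for t
    using g'[OF that] unfolding f'_def by (simp add: sums_iff)
  have df': "(f' has_real_derivative b t * f t) (at t within {a..c})" if "t \<in> {a..c}" for t
    using has_field_derivative_transform_within[OF conjunct2[OF g'[OF that]] zero_less_one that] gf' by blast
  have "y n a = (if n = 0 then A else 0)" "z n a = (if n = 0 then B else 0)" for n
    by (cases n; simp add: y0 z0 yS zS)+
  then have "f a = A" "f' a = B"
    using sums_unique[OF sums_single[of 0 "\<lambda>_. A"]] sums_unique[OF sums_single[of 0 "\<lambda>_. B"]]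
    unfolding f_def f'_def by simp_all
  with df df' that show ?thesis by blast
qed

text \<open>Gronwall's argument for the energy \<open>E = f^2 + f'^2\<close>. From
  \<open>E' \<le> (2 + C) * E + H^2\<close> it follows that
  \<open>exp (- (2 + C) * (t - a)) * E t - H^2 * (t - a)\<close> is nonincreasing, and it starts at
  0. With a positive \<open>H\<close> this measures dependence on a parameter; with
  \<open>H = 0\<close> it is uniqueness.\<close>

lemma linear_ode_stability:
  fixes f f' b h :: "real \<Rightarrow> real"
  assumes ac: "a < c" and cont: "continuous_on {a..c} f" "continuous_on {a..c} f'"
    and df: "\<And>t. t \<in> {a<..<c} \<Longrightarrow> (f has_real_derivative f' t) (at t)"
    and df': "\<And>t. t \<in> {a<..<c} \<Longrightarrow> (f' has_real_derivative b t * f t + h t) (at t)"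
    and init: "f a = 0" "f' a = 0"
    and b: "\<And>t. t \<in> {a<..<c} \<Longrightarrow> \<bar>b t\<bar> \<le> C" and h: "\<And>t. t \<in> {a<..<c} \<Longrightarrow> \<bar>h t\<bar> \<le> H"
  shows "(f c)\<^sup>2 \<le> exp ((2 + C) * (c - a)) * (c - a) * H\<^sup>2"
proof -
  define K where "K = 2 + C"
  define E where "E = (\<lambda>t. (f t)\<^sup>2 + (f' t)\<^sup>2)"
  define g where "g = (\<lambda>t. exp (- K * (t - a)) * E t - H\<^sup>2 * (t - a))"
  have "(a + c) / 2 \<in> {a<..<c}" using ac by auto
  from b[OF this] have C: "C \<ge> 0" by linarith
  have "g c \<le> g a"
  proof (rule DERIV_nonpos_imp_decreasing_open[of a c g])
    show "continuous_on {a..c} g"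
      unfolding g_def E_def by (intro continuous_intros cont)
    fix t assume "a < t" "t < c"
    then have t: "t \<in> {a<..<c}" by simp
    define E' where "E' = 2 * f t * f' t + 2 * f' t * (b t * f t + h t)"
    have A: "2 * f t * f' t \<le> (f t)\<^sup>2 + (f' t)\<^sup>2"
      using sum_squares_bound[of "f t" "f' t"] by simp
    have B: "2 * f' t * h t \<le> (f' t)\<^sup>2 + H\<^sup>2"
    proof -
      have "(h t)\<^sup>2 \<le> H\<^sup>2" using h[OF t] by (simp add: abs_le_square_iff[symmetric])
      then show ?thesis using sum_squares_bound[of "f' t" "h t"] by simp
    qed
    have CC: "2 * f' t * (b t * f t) \<le> C * ((f t)\<^sup>2 + (f' t)\<^sup>2)"
    proof -
      have "2 * f' t * (b t * f t) \<le> \<bar>b t\<bar> * \<bar>2 * f t * f' t\<bar>"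
        by (simp add: abs_mult[symmetric] mult_ac)
      also have "\<dots> \<le> C * ((f t)\<^sup>2 + (f' t)\<^sup>2)"
      proof (rule mult_mono)
        show "\<bar>2 * f t * f' t\<bar> \<le> (f t)\<^sup>2 + (f' t)\<^sup>2"
          using sum_squares_bound[of "f t" "f' t"] sum_squares_bound[of "f t" "- f' t"]
          by (simp add: abs_le_iff)
      qed (use b[OF t] C in auto)
      finally show ?thesis .
    qed
    have E': "E' \<le> K * E t + H\<^sup>2"
    proof -
      have "E' = 2 * f t * f' t + 2 * f' t * (b t * f t) + 2 * f' t * h t"
        and "K * E t = 2 * (f t)\<^sup>2 + 2 * (f' t)\<^sup>2 + C * ((f t)\<^sup>2 + (f' t)\<^sup>2)"
        by (simp_all add: E'_def E_def K_def algebra_simps)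
      then show ?thesis
        using A B CC zero_le_power2[of "f t"] by linarith
    qed
    have "(g has_real_derivative exp (- K * (t - a)) * (E' - K * E t) - H\<^sup>2) (at t)"
      unfolding g_def E_def E'_def using df[OF t] df'[OF t]
      by (auto intro!: derivative_eq_intros simp: algebra_simps power2_eq_square)
    \<comment> \<open>The weight lies in (0, 1], so it may be replaced by 1 when the other factor is
      nonnegative; otherwise the product is already at most 0.\<close>
    moreover have "exp (- K * (t - a)) * (E' - K * E t) \<le> 1 * H\<^sup>2"
    proof (cases "E' - K * E t \<ge> 0")
      case True
      then show ?thesis using E' \<open>a < t\<close> C by (intro mult_mono) (auto simp: K_def intro!: mult_nonpos_nonneg)
    next
      case False
      then have "exp (- K * (t - a)) * (E' - K * E t) \<le> 0"
        by (intro mult_nonneg_nonpos) auto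
      then show ?thesis by (smt (verit) zero_le_power2 mult_1)
    qed
    ultimately show "\<exists>y. (g has_real_derivative y) (at t) \<and> y \<le> 0"
      by auto
  qed (use ac in auto)
  then have "exp (- K * (c - a)) * E c \<le> H\<^sup>2 * (c - a)"
    by (simp add: g_def E_def init)
  then have "exp (K * (c - a)) * (exp (- K * (c - a)) * E c) \<le> exp (K * (c - a)) * (H\<^sup>2 * (c - a))"
    by (intro mult_left_mono) auto
  then have "E c \<le> exp (K * (c - a)) * (H\<^sup>2 * (c - a))"
    by (simp add: exp_minus mult.assoc[symmetric])
  then show ?thesis
    unfolding E_def K_def by (smt (verit) zero_le_power2 mult.assoc mult.commute)
qed

section \<open>Bounds for Dirichlet eigenvalues\<close>

text \<open>Maximum principle for the quotient of \<open>\<phi>\<close> by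
  \<open>cos (\<kappa> * t)\<close>, which is positive on the closed interval because
  \<open>\<kappa> < pi / 2\<close>. At an interior positive maximum of the quotient the Wronskian
  \<open>N\<close> vanishes, while its derivative there is
  \<open>(\<kappa>^2 - (q s + \<mu>)) * \<phi> s * \<psi> s > 0\<close>. So the quotient would still
  increase to the right of its maximum.\<close>

lemma no_positive_eigenfunction_value:
  assumes sol: "dirichlet_solution (\<lambda>t. q t * \<phi> t + \<mu> * \<phi> t) \<phi>"
    and q: "\<And>t. t \<in> {-1<..<1} \<Longrightarrow> q t + \<mu> < \<kappa>\<^sup>2"
    and \<kappa>: "0 \<le> \<kappa>" "\<kappa> < pi / 2"
    and t: "t \<in> {-1<..<1}"
  shows "\<phi> t \<le> 0"
proof (rule ccontr)
  assume "\<not> \<phi> t \<le> 0"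
  obtain \<phi>' where cont: "continuous_on {-1..1} \<phi>" and bd: "\<phi> (-1) = 0" "\<phi> 1 = 0"
    and d: "\<forall>t\<in>{-1<..<1}. (\<phi> has_real_derivative \<phi>' t) (at t) \<and>
      (\<phi>' has_real_derivative - (q t * \<phi> t + \<mu> * \<phi> t)) (at t)"
    using sol unfolding dirichlet_solution_def by (elim conjE exE)
  define \<psi> where "\<psi> = (\<lambda>t. cos (\<kappa> * t))"
  define z where "z = (\<lambda>t. \<phi> t / \<psi> t)"
  \<comment> \<open>The Wronskian of \<open>\<phi>\<close> and \<open>\<psi>\<close>, which is the
    numerator of the derivative of \<open>z\<close>.\<close>
  define N where "N = (\<lambda>t. \<phi>' t * \<psi> t + \<phi> t * (\<kappa> * sin (\<kappa> * t)))"
  have \<psi>: "\<psi> t > 0" if "t \<in> {-1..1}" for t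
  proof -
    have "\<bar>\<kappa> * t\<bar> \<le> \<kappa> * 1"
      unfolding abs_mult using that \<kappa> by (intro mult_mono) auto
    then show ?thesis
      unfolding \<psi>_def using \<kappa> by (intro cos_gt_zero_pi) linarith+
  qed
  have contz: "continuous_on {-1..1} z"
    unfolding z_def
  proof (intro continuous_on_divide cont ballI)
    show "continuous_on {-1..1} \<psi>"
      unfolding \<psi>_def by (intro continuous_intros)
    show "\<psi> r \<noteq> 0" if "r \<in> {-1..1}" for r
      using \<psi>[OF that] by simp
  qed
  then obtain s where s: "s \<in> {-1..1}" and max: "\<And>r. r \<in> {-1..1} \<Longrightarrow> z r \<le> z s"
    using continuous_attains_sup[of "{-1..1::real}" z] by auto
  have "0 < z t"
    using \<open>\<not> \<phi> t \<le> 0\<close> \<psi>[of t] t by (simp add: z_def)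
  then have zs: "z s > 0"
    using max[of t] t by auto
  then have "s \<noteq> -1" "s \<noteq> 1"
    by (auto simp: z_def bd)
  with s have s: "s \<in> {-1<..<1}" by auto
  have dz: "(z has_real_derivative N r / (\<psi> r)\<^sup>2) (at r)" if "r \<in> {-1<..<1}" for r
  proof -
    have "((\<lambda>t. \<phi> t / cos (\<kappa> * t)) has_real_derivative N r / (\<psi> r)\<^sup>2) (at r)"
      using d that \<psi>[of r]
      by (auto intro!: derivative_eq_intros simp: \<psi>_def N_def power2_eq_square)
    then show ?thesis by (simp add: z_def \<psi>_def)
  qed
  have "N s / (\<psi> s)\<^sup>2 = 0"
  proof (rule DERIV_local_max[OF dz[OF s]])
    show "min (s + 1) (1 - s) > 0" using s by auto
    show "\<forall>y. \<bar>s - y\<bar> < min (s + 1) (1 - s) \<longrightarrow> z y \<le> z s"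
      using max by (auto simp: abs_if split: if_splits)
  qed
  then have Ns: "N s = 0"
    using \<psi>[of s] s by simp
  have "(N has_real_derivative (\<kappa>\<^sup>2 - (q s + \<mu>)) * \<phi> s * \<psi> s) (at s)"
    unfolding N_def \<psi>_def using d s
    by (auto intro!: derivative_eq_intros simp: algebra_simps power2_eq_square)
  moreover have "\<phi> s > 0"
    using zs \<psi>[of s] s by (auto simp: z_def zero_less_divide_iff)
  then have "(\<kappa>\<^sup>2 - (q s + \<mu>)) * \<phi> s * \<psi> s > 0"
    using q[OF s] \<psi>[of s] s by simp
  ultimately obtain \<delta> where \<delta>: "\<delta> > 0" "\<And>h. 0 < h \<Longrightarrow> h < \<delta> \<Longrightarrow> N s < N (s + h)"
    using DERIV_pos_inc_right by blast
  obtain e where "0 < e" "e < min \<delta> (1 - s)"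
    using dense[of 0 "min \<delta> (1 - s)"] \<delta>(1) s by auto
  then have e: "e > 0" "e < \<delta>" "s + e < 1"
    by auto
  have "z s < z (s + e)"
  proof (rule DERIV_pos_imp_increasing_open[of s "s + e" z])
    show "continuous_on {s..s + e} z"
      using contz by (rule continuous_on_subset) (use s e in auto)
    fix x assume x: "s < x" "x < s + e"
    then have "N x / (\<psi> x)\<^sup>2 > 0"
      using \<delta>(2)[of "x - s"] e Ns \<psi>[of x] s by simp
    with dz[of x] show "\<exists>y. (z has_real_derivative y) (at x) \<and> 0 < y"
      using x s e by auto
  qed (use e in auto)
  with max[of "s + e"] s e show False by auto
qed

text \<open>If \<open>\<mu>\<close> were smaller, some \<open>\<kappa> < pi / 2\<close> would
  satisfy \<open>Q + \<mu> < \<kappa>^2\<close>. The maximum principle applied to the eigenfunction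
  and to its negative then makes it vanish identically.\<close>

lemma dirichlet_eigenvalue_ge:
  assumes ev: "dirichlet_eigenvalue q \<mu>" and q: "\<And>t. t \<in> {-1<..<1} \<Longrightarrow> q t \<le> Q"
  shows "pi\<^sup>2 / 4 - Q \<le> \<mu>"
proof (rule ccontr)
  assume "\<not> pi\<^sup>2 / 4 - Q \<le> \<mu>"
  moreover have "(pi / 2)\<^sup>2 = pi\<^sup>2 / 4" "(pi / 2)\<^sup>2 > 0"
    by (simp_all add: power_divide)
  \<comment> \<open>The truncation at 0 keeps the square root meaningful when
    \<open>Q + \<mu>\<close> is negative.\<close>
  ultimately have "max 0 (Q + \<mu>) < (pi / 2)\<^sup>2"
    by simp
  then have "sqrt (max 0 (Q + \<mu>)) < pi / 2"
    by (intro real_less_lsqrt) auto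
  then obtain \<kappa> where \<kappa>: "sqrt (max 0 (Q + \<mu>)) < \<kappa>" "\<kappa> < pi / 2"
    using dense by blast
  have "0 \<le> sqrt (max 0 (Q + \<mu>))" by simp
  with \<kappa>(1) have "0 \<le> \<kappa>" by linarith
  have "max 0 (Q + \<mu>) < \<kappa>\<^sup>2"
    using \<kappa>(1) by (meson not_le real_le_rsqrt)
  then have less: "q t + \<mu> < \<kappa>\<^sup>2" if "t \<in> {-1<..<1}" for t
    using q[OF that] by simp
  obtain \<phi> where sol: "dirichlet_solution (\<lambda>t. q t * \<phi> t + \<mu> * \<phi> t) \<phi>"
    and nz: "\<exists>t\<in>{-1<..<1}. \<phi> t \<noteq> 0"
    using ev unfolding dirichlet_eigenvalue_def by blast
  have "dirichlet_solution (\<lambda>t. q t * - \<phi> t + \<mu> * - \<phi> t) (\<lambda>t. - \<phi> t)"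
  proof -
    obtain \<phi>' where cont: "continuous_on {-1..1} \<phi>" and bd: "\<phi> (-1) = 0" "\<phi> 1 = 0"
      and d: "\<forall>t\<in>{-1<..<1}. (\<phi> has_real_derivative \<phi>' t) (at t) \<and>
        (\<phi>' has_real_derivative - (q t * \<phi> t + \<mu> * \<phi> t)) (at t)"
      using sol unfolding dirichlet_solution_def by (elim conjE exE)
    then show ?thesis
      unfolding dirichlet_solution_def
      by (intro conjI exI[of _ "\<lambda>t. - \<phi>' t"])
        (auto intro!: continuous_intros derivative_eq_intros)
  qed
  then have "\<phi> t = 0" if "t \<in> {-1<..<1}" for t
    using no_positive_eigenfunction_value[OF sol less \<open>0 \<le> \<kappa>\<close> \<kappa>(2) that]
      no_positive_eigenfunction_value[of q "\<lambda>t. - \<phi> t" \<mu>, OF _ less \<open>0 \<le> \<kappa>\<close> \<kappa>(2) that] by auto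
  with nz show False by blast
qed

text \<open>Shooting: \<open>F \<mu>\<close> solves the eigenvalue equation with value 0 and slope 1
  at the left end. The number \<open>F \<mu> 1\<close> depends continuously on \<open>\<mu>\<close>,
  is at most 0 for \<open>\<mu> = 0\<close> by comparison with \<open>y\<close>, and is at least 0
  for \<open>\<mu> = - C\<close> with \<open>C\<close> a bound of the potential. A zero in between
  gives an eigenvalue.\<close>

lemma dirichlet_eigenvalue_nonpos_exists:
  assumes contq: "continuous_on {-1..1} q"
    and conty: "continuous_on {-1..1} y" "continuous_on {-1..1} y'"
    and dy: "\<And>t. t \<in> {-1<..<1} \<Longrightarrow> (y has_real_derivative y' t) (at t)"
      "\<And>t. t \<in> {-1<..<1} \<Longrightarrow> (y' has_real_derivative - (q t * y t)) (at t)"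
    and bd: "y (-1) = 0" "y' (-1) > 0" "y 1 < 0"
  obtains \<mu> where "\<mu> \<le> 0" "dirichlet_eigenvalue q \<mu>"
proof -
  have "bounded (q ` {-1..1})"
    using compact_continuous_image[OF contq] compact_imp_bounded by blast
  then obtain C where C: "C > 0" "\<And>t. t \<in> {-1..1} \<Longrightarrow> \<bar>q t\<bar> \<le> C"
    unfolding bounded_pos by auto
  have "\<exists>f f'. f (-1) = 0 \<and> f' (-1) = 1 \<and>
      (\<forall>t\<in>{-1..1}. (f has_real_derivative f' t) (at t within {-1..1}) \<and>
        (f' has_real_derivative - (q t + \<mu>) * f t) (at t within {-1..1}))" for \<mu>
  proof (rule linear_ivp_exists[of "-1" 1 "\<lambda>t. - (q t + \<mu>)" 0 1])
    show "continuous_on {-1..1} (\<lambda>t. - (q t + \<mu>))"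
      by (intro continuous_intros contq)
  qed (simp, blast)
  then obtain F G where F0: "\<And>\<mu>. F \<mu> (-1) = 0" and G0: "\<And>\<mu>. G \<mu> (-1) = 1"
    and FG: "\<And>\<mu>. \<forall>t\<in>{-1..1}. (F \<mu> has_real_derivative G \<mu> t) (at t within {-1..1}) \<and>
        (G \<mu> has_real_derivative - (q t + \<mu>) * F \<mu> t) (at t within {-1..1})"
    by metis
  have dF: "(F \<mu> has_real_derivative G \<mu> t) (at t within {-1..1})"
    and dG: "(G \<mu> has_real_derivative - (q t + \<mu>) * F \<mu> t) (at t within {-1..1})"
    if "t \<in> {-1..1}" for t \<mu>
    using FG that by auto
  have dF': "(F \<mu> has_real_derivative G \<mu> t) (at t)"
    and dG': "(G \<mu> has_real_derivative - (q t + \<mu>) * F \<mu> t) (at t)"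
    if "t \<in> {-1<..<1}" for t \<mu>
    using dF[of t] dG[of t] that by (auto simp: at_within_Icc_at)
  have contF: "continuous_on {-1..1} (F \<mu>)" for \<mu>
    using dF by (rule DERIV_continuous_on)
  have contG: "continuous_on {-1..1} (G \<mu>)" for \<mu>
    using dG by (rule DERIV_continuous_on)
  \<comment> \<open>Positivity just to the right of -1 follows from the slope 1. It shows that the
    eigenfunction found by shooting is nontrivial, and it starts the argument for
    \<open>\<mu> = - C\<close>.\<close>
  have pos: "\<exists>s\<in>{-1<..<1}. F \<mu> s > 0" for \<mu>
  proof -
    obtain d where d: "d > 0" "\<And>h. h > 0 \<Longrightarrow> -1 + h \<in> {-1..1} \<Longrightarrow> h < d \<Longrightarrow> F \<mu> (-1) < F \<mu> (-1 + h)"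
      using has_real_derivative_pos_inc_right[OF dF[of "-1" \<mu>]] G0[of \<mu>] by auto
    have "F \<mu> (-1) < F \<mu> (-1 + min d 1 / 2)"
      using d(1) by (intro d(2)) (auto simp: min_def)
    moreover have "-1 + min d 1 / 2 \<in> {-1<..<1}"
      using d(1) by (auto simp: min_def)
    ultimately show ?thesis
      unfolding F0 by blast
  qed
  have "continuous_on {- C..0} (\<lambda>\<mu>. F \<mu> 1)"
    unfolding continuous_on_def
  proof
    fix \<mu> assume \<mu>: "\<mu> \<in> {- C..0}"
    have "bounded (F \<mu> ` {-1..1})"
      using compact_continuous_image[OF contF] compact_imp_bounded by blast
    then obtain B where B: "B > 0" "\<And>t. t \<in> {-1..1} \<Longrightarrow> \<bar>F \<mu> t\<bar> \<le> B"
      unfolding bounded_pos by auto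
    \<comment> \<open>The Lipschitz constant is the square root of the stability factor for a
      coefficient bounded by \<open>2 * C\<close> on an interval of length 2, times the bound
      \<open>B\<close> of \<open>F \<mu>\<close>.\<close>
    define L where "L = sqrt (exp ((2 + 2 * C) * 2) * 2) * B"
    have "\<bar>F \<nu> 1 - F \<mu> 1\<bar> \<le> L * \<bar>\<nu> - \<mu>\<bar>" if \<nu>: "\<nu> \<in> {- C..0}" for \<nu>
    proof -
      \<comment> \<open>The difference solves the equation with parameter \<open>\<nu>\<close>, zero
        initial data and the source \<open>(\<mu> - \<nu>) * F \<mu> t\<close>.\<close>
      have "(F \<nu> 1 - F \<mu> 1)\<^sup>2 \<le> exp ((2 + 2 * C) * (1 - (-1))) * (1 - (-1)) * (\<bar>\<nu> - \<mu>\<bar> * B)\<^sup>2"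
      proof (rule linear_ode_stability[where f' = "\<lambda>t. G \<nu> t - G \<mu> t" and b = "\<lambda>t. - (q t + \<nu>)"
            and h = "\<lambda>t. (\<mu> - \<nu>) * F \<mu> t"])
        show "continuous_on {-1..1} (\<lambda>t. F \<nu> t - F \<mu> t)" "continuous_on {-1..1} (\<lambda>t. G \<nu> t - G \<mu> t)"
          by (intro continuous_intros contF contG)+
        fix t :: real assume t: "t \<in> {-1<..<1}"
        show "((\<lambda>t. F \<nu> t - F \<mu> t) has_real_derivative G \<nu> t - G \<mu> t) (at t)"
          using dF'[OF t] by (intro derivative_intros)
        show "((\<lambda>t. G \<nu> t - G \<mu> t) has_real_derivative
            - (q t + \<nu>) * (F \<nu> t - F \<mu> t) + (\<mu> - \<nu>) * F \<mu> t) (at t)"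
          by (rule derivative_eq_intros dG'[OF t] refl)+ (simp add: algebra_simps)
        show "\<bar>- (q t + \<nu>)\<bar> \<le> 2 * C"
          using C(2)[of t] t \<nu> by (auto simp: abs_le_iff)
        show "\<bar>(\<mu> - \<nu>) * F \<mu> t\<bar> \<le> \<bar>\<nu> - \<mu>\<bar> * B"
          using B(2)[of t] t unfolding abs_mult by (intro mult_mono) auto
      qed (simp_all add: F0 G0)
      also have "\<dots> = (L * \<bar>\<nu> - \<mu>\<bar>)\<^sup>2"
        by (simp add: L_def power_mult_distrib)
      finally have "(F \<nu> 1 - F \<mu> 1)\<^sup>2 \<le> (L * \<bar>\<nu> - \<mu>\<bar>)\<^sup>2" .
      moreover have "L * \<bar>\<nu> - \<mu>\<bar> \<ge> 0"
        using B by (auto simp: L_def)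
      ultimately show ?thesis
        by (metis abs_le_square_iff abs_of_nonneg)
    qed
    then have "\<forall>\<^sub>F \<nu> in at \<mu> within {- C..0}. norm (F \<nu> 1 - F \<mu> 1) \<le> L * \<bar>\<nu> - \<mu>\<bar>"
      by (auto simp: eventually_at_filter)
    moreover have "((\<lambda>\<nu>. L * \<bar>\<nu> - \<mu>\<bar>) \<longlongrightarrow> 0) (at \<mu> within {- C..0})"
      by (auto intro!: tendsto_eq_intros)
    ultimately have "((\<lambda>\<nu>. F \<nu> 1 - F \<mu> 1) \<longlongrightarrow> 0) (at \<mu> within {- C..0})"
      by (rule Lim_null_comparison)
    then show "((\<lambda>\<nu>. F \<nu> 1) \<longlongrightarrow> F \<mu> 1) (at \<mu> within {- C..0})"
      by (rule LIM_zero_cancel)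
  qed
  moreover have "F 0 1 \<le> 0"
  proof -
    define k where "k = y' (-1)"
    \<comment> \<open>Both \<open>y\<close> and \<open>k * F 0\<close> solve the same equation with
      the same data at -1, so stability with zero source identifies them at 1.\<close>
    have "(y 1 - k * F 0 1)\<^sup>2 \<le> exp ((2 + C) * (1 - (-1))) * (1 - (-1)) * 0\<^sup>2"
    proof (rule linear_ode_stability[where f' = "\<lambda>t. y' t - k * G 0 t" and b = "\<lambda>t. - q t"
          and h = "\<lambda>t. 0"])
      show "continuous_on {-1..1} (\<lambda>t. y t - k * F 0 t)" "continuous_on {-1..1} (\<lambda>t. y' t - k * G 0 t)"
        by (intro continuous_intros contF contG conty)+
      fix t :: real assume t: "t \<in> {-1<..<1}"
      show "((\<lambda>t. y t - k * F 0 t) has_real_derivative y' t - k * G 0 t) (at t)"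
        by (rule derivative_eq_intros dF'[OF t] dy(1)[OF t] refl)+ simp
      show "((\<lambda>t. y' t - k * G 0 t) has_real_derivative - q t * (y t - k * F 0 t) + 0) (at t)"
        by (rule derivative_eq_intros dG'[OF t] dy(2)[OF t] refl)+ (simp add: algebra_simps)
      show "\<bar>- q t\<bar> \<le> C"
        using C(2)[of t] t by auto
    qed (simp_all add: F0 G0 bd k_def)
    then have "y 1 = k * F 0 1" by simp
    with bd show ?thesis
      unfolding k_def by (metis less_eq_real_def mult_pos_pos not_less)
  qed
  moreover have "F (- C) 1 \<ge> 0"
  proof (rule ccontr)
    assume "\<not> F (- C) 1 \<ge> 0"
    obtain s where s: "s \<in> {-1<..<1}" "F (- C) s > 0"
      using pos by blast
    have "\<exists>r\<ge>s. r \<le> 1 \<and> F (- C) r = 0"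
      using s \<open>\<not> F (- C) 1 \<ge> 0\<close>
      by (intro IVT2' continuous_on_subset[OF contF]) auto
    then obtain r where r: "s \<le> r" "r \<le> 1" "F (- C) r = 0" by blast
    \<comment> \<open>\<open>g\<close> is half the derivative of the square of
      \<open>F (- C)\<close>. Its own derivative \<open>G^2 + (C - q) * F^2\<close> is nonnegative
      and it starts at 0, so the square never decreases and \<open>F (- C)\<close> cannot return to
      0 after being positive.\<close>
    define g where "g = (\<lambda>t. F (- C) t * G (- C) t)"
    have g: "g t \<ge> 0" if "t \<in> {-1<..<1}" for t
    proof -
      have "g (-1) \<le> g t"
      proof (rule DERIV_nonneg_imp_increasing_open[of "-1" t g])
        show "continuous_on {-1..t} g"
          unfolding g_def using that
          by (intro continuous_intros continuous_on_subset[OF contF] continuous_on_subset[OF contG]) auto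
        fix x assume "-1 < x" "x < t"
        then have x: "x \<in> {-1<..<1}" using that by auto
        have "(g has_real_derivative (G (- C) x)\<^sup>2 + (C - q x) * (F (- C) x)\<^sup>2) (at x)"
          unfolding g_def
          by (rule derivative_eq_intros dF'[OF x] dG'[OF x] refl)+
            (simp add: algebra_simps power2_eq_square)
        moreover have "C - q x \<ge> 0"
          using C(2)[of x] x by (auto simp: abs_le_iff)
        ultimately show "\<exists>y. (g has_real_derivative y) (at x) \<and> 0 \<le> y"
          by auto
      qed (use that in auto)
      then show ?thesis by (simp add: g_def F0)
    qed
    have "(F (- C) s)\<^sup>2 \<le> (F (- C) r)\<^sup>2"
    proof (rule DERIV_nonneg_imp_increasing_open[of s r "\<lambda>t. (F (- C) t)\<^sup>2"])
      show "continuous_on {s..r} (\<lambda>t. (F (- C) t)\<^sup>2)"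
        using s r by (intro continuous_intros continuous_on_subset[OF contF]) auto
      fix x assume "s < x" "x < r"
      then have x: "x \<in> {-1<..<1}" using s r by auto
      have "((\<lambda>t. (F (- C) t)\<^sup>2) has_real_derivative 2 * g x) (at x)"
        by (rule derivative_eq_intros dF'[OF x] refl)+ (simp add: g_def)
      with g[OF x] show "\<exists>y. ((\<lambda>t. (F (- C) t)\<^sup>2) has_real_derivative y) (at x) \<and> 0 \<le> y"
        by (intro exI[of _ "2 * g x"]) auto
    qed (use r in auto)
    with s r show False by simp
  qed
  ultimately obtain \<mu> where \<mu>: "- C \<le> \<mu>" "\<mu> \<le> 0" "F \<mu> 1 = 0"
    using IVT2'[of "\<lambda>\<mu>. F \<mu> 1" 0 0 "- C"] C by auto
  have "dirichlet_solution (\<lambda>t. q t * F \<mu> t + \<mu> * F \<mu> t) (F \<mu>)"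
    unfolding dirichlet_solution_def using contF F0 \<mu>(3) dF' dG'
    by (intro conjI exI[of _ "G \<mu>"]) (auto simp: algebra_simps)
  moreover have "\<exists>t\<in>{-1<..<1}. F \<mu> t \<noteq> 0"
    using pos[of \<mu>] by force
  ultimately show ?thesis
    using that \<mu>(2) unfolding dirichlet_eigenvalue_def by blast
qed

section \<open>The normalized solution\<close>

text \<open>For the upper bound, write \<open>s powr p = s * exp ((p - 1) * ln s)\<close>. Then
  \<open>exp x \<ge> 1 + x\<close> bounds the difference by \<open>(p - 1) * (s * - ln s)\<close>,
  and \<open>- ln s \<le> 1 / s - 1\<close> bounds the last factor by 1.\<close>

lemma diff_powr_bounds:
  fixes s p :: real
  assumes "0 \<le> s" "s \<le> 1" "1 < p"
  shows "0 \<le> s - s powr p" "s - s powr p \<le> p - 1"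
proof -
  show "0 \<le> s - s powr p"
    using powr_mono'[of 1 p s] assms by simp
  show "s - s powr p \<le> p - 1"
  proof (cases "s = 0")
    case False
    with assms have s: "s > 0" by simp
    have "s powr p = s * exp ((p - 1) * ln s)"
      using s by (simp add: powr_def left_diff_distrib exp_diff)
    moreover have "s * exp ((p - 1) * ln s) \<ge> s * (1 + (p - 1) * ln s)"
      using s by (intro mult_left_mono exp_ge_add_one_self) auto
    ultimately have "s - s powr p \<le> (p - 1) * (s * - ln s)"
      by (simp add: algebra_simps)
    also have "\<dots> \<le> (p - 1) * 1"
    proof (rule mult_left_mono)
      have "- ln s \<le> 1 / s - 1"
        using ln_le_minus_one[of "1 / s"] s by (simp add: ln_div)
      then have "s * - ln s \<le> s * (1 / s - 1)"
        using s by (intro mult_left_mono) auto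
      then show "s * - ln s \<le> 1"
        using s by (simp add: right_diff_distrib)
    qed (use assms in auto)
    finally show ?thesis by simp
  qed (use assms in auto)
qed

text \<open>The product of \<open>1 - y + y^2 / 2\<close> and \<open>1 + y + y^2 / 2\<close> is
  \<open>1 + y^4 / 4\<close>, hence at least 1, and the second factor is at most
  \<open>exp y\<close>.\<close>

lemma exp_minus_le_quadratic:
  fixes y :: real
  assumes "0 \<le> y"
  shows "exp (- y) \<le> 1 - y + y\<^sup>2 / 2"
proof -
  have "(1 - y + y\<^sup>2 / 2) * (1 + y + y\<^sup>2 / 2) = 1 + (y\<^sup>2)\<^sup>2 / 4"
    by (simp add: field_simps power2_eq_square)
  then have *: "(1 - y + y\<^sup>2 / 2) * (1 + y + y\<^sup>2 / 2) \<ge> 1"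
    by simp
  have pos: "1 + y + y\<^sup>2 / 2 > 0"
    using assms by (intro add_pos_nonneg) auto
  have "1 - y + y\<^sup>2 / 2 \<ge> 0"
    using * pos by (smt (verit) mult_nonpos_nonneg)
  then have "(1 - y + y\<^sup>2 / 2) * (1 + y + y\<^sup>2 / 2) \<le> (1 - y + y\<^sup>2 / 2) * exp y"
    using exp_lower_Taylor_quadratic[OF assms] by (rule mult_left_mono[rotated])
  with * show ?thesis
    by (simp add: exp_minus field_simps)
qed

text \<open>With \<open>s = exp (- x)\<close> and \<open>e = p - 1\<close> the quotient is
  \<open>s * (1 - exp (- e * x)) / e\<close>, which lies between
  \<open>s * (x - e * x^2 / 2)\<close> and \<open>s * x\<close>. Since
  \<open>x^2 / 2 \<le> exp x\<close>, the gap is at most \<open>e\<close>, uniformly in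
  \<open>s\<close>. This uniformity later allows the argument to depend on \<open>p\<close>. At
  \<open>s = 0\<close> both terms are 0.\<close>

lemma diff_powr_quotient_approx:
  fixes s p :: real
  assumes "0 \<le> s" "s \<le> 1" "1 < p"
  shows "\<bar>(s - s powr p) / (p - 1) - s * - ln s\<bar> \<le> p - 1"
proof (cases "s = 0")
  case False
  with assms have s: "s > 0" by simp
  define x where "x = - ln s"
  define e where "e = p - 1"
  have x: "x \<ge> 0" and e: "e > 0" and s_eq: "s = exp (- x)"
    using assms s by (auto simp: x_def e_def)
  have "s powr p = s * exp (- (e * x))"
    using s by (simp add: powr_def e_def x_def left_diff_distrib exp_diff)
  then have q: "(s - s powr p) / (p - 1) = s * ((1 - exp (- (e * x))) / e)"
    by (simp add: e_def right_diff_distrib)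
  have "(1 - exp (- (e * x))) / e \<le> x"
    using exp_ge_add_one_self[of "- (e * x)"] e by (simp add: divide_le_eq mult.commute)
  then have up: "s * ((1 - exp (- (e * x))) / e) \<le> s * x"
    using s by (intro mult_left_mono) auto
  have "x - e * (x\<^sup>2 / 2) = (e * x - (e * x)\<^sup>2 / 2) / e"
    using e by (simp add: field_simps power2_eq_square)
  also have "\<dots> \<le> (1 - exp (- (e * x))) / e"
    using exp_minus_le_quadratic[of "e * x"] x e by (intro divide_right_mono) auto
  finally have "s * (x - e * (x\<^sup>2 / 2)) \<le> s * ((1 - exp (- (e * x))) / e)"
    using s by (intro mult_left_mono) auto
  moreover have "s * (x - e * (x\<^sup>2 / 2)) = s * x - e * (s * (x\<^sup>2 / 2))"
    by (simp add: algebra_simps)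
  moreover have "e * (s * (x\<^sup>2 / 2)) \<le> e * 1"
  proof (rule mult_left_mono)
    have "x\<^sup>2 / 2 \<le> exp x"
      using exp_lower_Taylor_quadratic[OF x] x by simp
    then show "s * (x\<^sup>2 / 2) \<le> 1"
      unfolding s_eq by (simp add: exp_minus field_simps)
  qed (use e in auto)
  ultimately show ?thesis
    unfolding q x_def[symmetric] using up by (simp add: e_def abs_le_iff)
qed (use assms in auto)

section \<open>The first eigenfunction and the constants of the estimates\<close>

lemma phi1_nonneg: "t \<in> {-1..1} \<Longrightarrow> phi1 t \<ge> 0"
  unfolding phi1_def using mult_left_mono[of "-1" t "pi / 2"] mult_left_mono[of t 1 "pi / 2"]
  by (intro cos_ge_zero) auto

lemma phi1_pos: "t \<in> {-1<..<1} \<Longrightarrow> phi1 t > 0"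
  unfolding phi1_def using mult_strict_left_mono[of "-1" t "pi / 2"] mult_strict_left_mono[of t 1 "pi / 2"]
  by (intro cos_gt_zero_pi) auto

lemma phi1_le_1: "phi1 t \<le> 1"
  by (simp add: phi1_def)

lemma phi1_ends: "phi1 (-1) = 0" "phi1 1 = 0"
  by (simp_all add: phi1_def)

lemma continuous_on_phi1 [continuous_intros]: "continuous_on S phi1"
  unfolding phi1_def by (intro continuous_intros)

lemma phi1_has_real_derivative:
  "(phi1 has_real_derivative - (pi / 2 * sin (pi / 2 * t))) (at t within S)"
  unfolding phi1_def by (auto intro!: derivative_eq_intros)

text \<open>A lower bound, independent of the solution, for the integral of
  \<open>v powr p * phi1\<close>. The tent lies below \<open>v\<close> by concavity, and it is
  squared because \<open>v powr p \<ge> v^2\<close> for \<open>p \<le> 2\<close> and values in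
  [0, 1].\<close>

definition tent_mass :: real where
  "tent_mass = integral {-1..1} (\<lambda>t. ((1 - \<bar>t\<bar>) / 2)\<^sup>2 * phi1 t)"

lemma tent_mass_pos: "tent_mass > 0"
proof -
  let ?f = "\<lambda>t. ((1 - \<bar>t\<bar>) / 2)\<^sup>2 * phi1 t"
  have cont: "continuous_on {-1..1} ?f"
    by (intro continuous_intros) auto
  have "\<exists>t\<in>{-1..1}. ?f t \<noteq> 0"
    by (rule bexI[of _ 0]) (auto simp: phi1_def)
  then have "tent_mass \<noteq> 0"
    unfolding tent_mass_def using integral_eq_0_iff[OF cont] phi1_nonneg by auto
  moreover have "tent_mass \<ge> 0"
    unfolding tent_mass_def using phi1_nonneg
    by (intro integral_nonneg integrable_continuous_real cont) auto
  ultimately show ?thesis by simp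
qed

text \<open>The first summand accounts for replacing \<open>v powr p\<close> by \<open>v\<close>,
  the second for replacing \<open>lam\<close> by \<open>pi^2 / 4\<close>; each costs its constant
  times \<open>p - 1\<close>.\<close>

definition resid_const :: real where
  "resid_const = pi\<^sup>2 / 4 + pi\<^sup>2 / 2 / tent_mass"

lemma resid_const_pos: "resid_const > 0"
  unfolding resid_const_def using tent_mass_pos by (intro add_pos_pos) auto

text \<open>The rescaled problem, with \<open>v\<close> standing for the solution divided by its
  maximum and \<open>t0\<close> for a point where the maximum is attained. The position of
  \<open>t0\<close> is left open; the estimates below show that it is close to 0.\<close>

locale normalized_solution =
  fixes p lam t0 :: real and v v' :: "real \<Rightarrow> real"
  assumes p: "1 < p" and lam: "lam > 0"
    and v_ends: "v (-1) = 0" "v 1 = 0"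
    and t0: "t0 \<in> {-1<..<1}" "v t0 = 1" "v' t0 = 0"
    and v_nonneg: "\<And>t. t \<in> {-1..1} \<Longrightarrow> 0 \<le> v t"
    and v_le_1: "\<And>t. t \<in> {-1..1} \<Longrightarrow> v t \<le> 1"
    and v_pos: "\<And>t. t \<in> {-1<..<1} \<Longrightarrow> 0 < v t"
    and dv: "\<And>t. t \<in> {-1..1} \<Longrightarrow> (v has_real_derivative v' t) (at t within {-1..1})"
    and dv': "\<And>t. t \<in> {-1..1} \<Longrightarrow> (v' has_real_derivative - (lam * v t powr p)) (at t within {-1..1})"
begin

section \<open>Regularity and concavity of the normalized solution\<close>

lemma cont_v: "continuous_on {-1..1} v"
  using dv by (rule DERIV_continuous_on)

lemma cont_v': "continuous_on {-1..1} v'"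
  using dv' by (rule DERIV_continuous_on)

lemma cont_v_powr: "0 < a \<Longrightarrow> continuous_on {-1..1} (\<lambda>t. v t powr a)"
  using v_nonneg by (intro continuous_on_powr' cont_v continuous_intros) auto

lemma v'_antimono:
  assumes "-1 \<le> s" "s \<le> t" "t \<le> 1"
  shows "v' t \<le> v' s"
proof (rule DERIV_nonpos_imp_decreasing_open[of s t v'])
  show "continuous_on {s..t} v'"
    using cont_v' by (rule continuous_on_subset) (use assms in auto)
  fix x assume "s < x" "x < t"
  then have "x \<in> {-1<..<1}" using assms by auto
  then show "\<exists>y. (v' has_real_derivative y) (at x) \<and> y \<le> 0"
    using dv'[of x] lam by (intro exI[of _ "- (lam * v x powr p)"]) (auto simp: at_within_Icc_at)
qed (use assms in auto)

lemma v_mvt: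
  assumes "-1 \<le> s" "s < t" "t \<le> 1"
  obtains x where "s < x" "x < t" "v t - v s = (t - s) * v' x"
proof -
  have "\<exists>x>s. x < t \<and> v t - v s = v' x * (t - s)"
  proof (rule mvt[of s t v "\<lambda>x. (*) (v' x)"])
    show "continuous_on {s..t} v"
      using cont_v by (rule continuous_on_subset) (use assms in auto)
    show "(v has_derivative (*) (v' x)) (at x)" if "s < x" "x < t" for x
      using dv[of x] that assms by (simp add: at_within_Icc_at has_field_derivative_def)
  qed (use assms in auto)
  with that show ?thesis by (auto simp: mult.commute)
qed

text \<open>By concavity \<open>v\<close> lies above the chords joining its maximum, of height 1, to
  the zeros at both ends. Each chord spans a length of at most 2, so its slope is at least 1/2 in
  modulus.\<close>

lemma v_ge_tent:
  assumes t: "t \<in> {-1..1}"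
  shows "(1 - \<bar>t\<bar>) / 2 \<le> v t"
proof -
  \<comment> \<open>Decreasing slopes of adjacent chords, with the denominators cleared; the mean
    value theorem turns the slopes into values of \<open>v'\<close>.\<close>
  have chord: "(v b - v s) * (s - a) \<le> (v s - v a) * (b - s)"
    if ab: "-1 \<le> a" "a < s" "s < b" "b \<le> 1" for a b s
  proof -
    obtain x where x: "a < x" "x < s" "v s - v a = (s - a) * v' x"
      using v_mvt[of a s] ab by auto
    obtain y where y: "s < y" "y < b" "v b - v s = (b - s) * v' y"
      using v_mvt[of s b] ab by auto
    have "v' y * ((b - s) * (s - a)) \<le> v' x * ((b - s) * (s - a))"
      using v'_antimono[of x y] x y that by (intro mult_right_mono) auto
    then show ?thesis
      unfolding x y by (simp add: mult_ac)
  qed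
  consider "t = -1" | "t = 1" | "t = t0" | "-1 < t" "t < t0" | "t0 < t" "t < 1"
    using t by fastforce
  then show ?thesis
  proof cases
    case 4
    have "(1 - v t) * (t + 1) \<le> v t * (t0 - t)"
      using chord[of "-1" t t0] 4 t0 v_ends by simp
    then have "t + 1 \<le> v t * (t0 + 1)"
      by (simp add: algebra_simps)
    also have "\<dots> \<le> v t * 2"
      using t0 v_nonneg[OF t] by (intro mult_left_mono) auto
    finally show ?thesis by simp
  next
    case 5
    have "- v t * (t - t0) \<le> (v t - 1) * (1 - t)"
      using chord[of t0 t 1] 5 t0 v_ends by simp
    then have "1 - t \<le> v t * (1 - t0)"
      by (simp add: algebra_simps)
    also have "\<dots> \<le> v t * 2"
      using t0 v_nonneg[OF t] by (intro mult_left_mono) auto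
    finally show ?thesis by simp
  qed (use v_ends t0 in auto)
qed

text \<open>Green's identity for \<open>v\<close> and \<open>phi1\<close>: their Wronskian
  \<open>G\<close> vanishes at both ends, so its derivative has integral 0.\<close>

lemma weighted_identity:
  "(lam - pi\<^sup>2 / 4) * integral {-1..1} (\<lambda>t. v t powr p * phi1 t)
    = pi\<^sup>2 / 4 * integral {-1..1} (\<lambda>t. (v t - v t powr p) * phi1 t)"
proof -
  define G where "G = (\<lambda>t. v' t * phi1 t + v t * (pi / 2 * sin (pi / 2 * t)))"
  have "(G has_real_derivative - (lam * (v t powr p * phi1 t)) + pi\<^sup>2 / 4 * (v t * phi1 t))
      (at t within {-1..1})" if "t \<in> {-1..1}" for t
    unfolding G_def
    by (rule derivative_eq_intros dv[OF that] dv'[OF that] phi1_has_real_derivative refl)+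
      (simp add: algebra_simps phi1_def power2_eq_square)
  then have "((\<lambda>t. - (lam * (v t powr p * phi1 t)) + pi\<^sup>2 / 4 * (v t * phi1 t)) has_integral
      G 1 - G (-1)) {-1..1}"
    by (intro fundamental_theorem_of_calculus)
      (auto simp flip: has_real_derivative_iff_has_vector_derivative)
  then have *: "integral {-1..1} (\<lambda>t. - (lam * (v t powr p * phi1 t)) + pi\<^sup>2 / 4 * (v t * phi1 t)) = 0"
    by (simp add: integral_unique G_def v_ends phi1_ends)
  have int: "(\<lambda>t. v t powr p * phi1 t) integrable_on {-1..1}" "(\<lambda>t. v t * phi1 t) integrable_on {-1..1}"
    using p by (intro integrable_continuous_real continuous_intros cont_v cont_v_powr; simp)+
  have e1: "integral {-1..1} (\<lambda>t. - (lam * (v t powr p * phi1 t)) + pi\<^sup>2 / 4 * (v t * phi1 t))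
      = - (lam * integral {-1..1} (\<lambda>t. v t powr p * phi1 t))
        + pi\<^sup>2 / 4 * integral {-1..1} (\<lambda>t. v t * phi1 t)"
    using int by (subst integral_add) (auto intro: integrable_neg integrable_on_mult_right)
  have e2: "integral {-1..1} (\<lambda>t. (v t - v t powr p) * phi1 t)
      = integral {-1..1} (\<lambda>t. v t * phi1 t) - integral {-1..1} (\<lambda>t. v t powr p * phi1 t)"
    unfolding left_diff_distrib using int by (intro integral_diff)
  show ?thesis
    unfolding e2 using *[unfolded e1] by (simp add: left_diff_distrib right_diff_distrib)
qed

lemma integral_powr_pos: "0 < integral {-1..1} (\<lambda>t. v t powr p * phi1 t)"
proof -
  have cont: "continuous_on {-1..1} (\<lambda>t. v t powr p * phi1 t)"
    using p by (intro continuous_intros cont_v_powr) auto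
  have "integral {-1..1} (\<lambda>t. v t powr p * phi1 t) \<noteq> 0"
    using integral_eq_0_iff[OF cont] phi1_nonneg phi1_pos[of t0] t0
    by (auto intro!: bexI[of _ t0])
  moreover have "integral {-1..1} (\<lambda>t. v t powr p * phi1 t) \<ge> 0"
    using phi1_nonneg by (intro integral_nonneg integrable_continuous_real cont) auto
  ultimately show ?thesis by simp
qed

text \<open>Since \<open>v powr p \<le> v\<close>, the right side of the weighted identity is
  nonnegative, while the integral multiplying \<open>lam - pi^2 / 4\<close> is positive.\<close>

lemma lam_ge: "pi\<^sup>2 / 4 \<le> lam"
proof -
  have "0 \<le> integral {-1..1} (\<lambda>t. (v t - v t powr p) * phi1 t)"
    using p phi1_nonneg diff_powr_bounds(1) v_nonneg v_le_1
    by (intro integral_nonneg integrable_continuous_real continuous_intros cont_v cont_v_powr) auto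
  then have "0 \<le> (lam - pi\<^sup>2 / 4) * integral {-1..1} (\<lambda>t. v t powr p * phi1 t)"
    unfolding weighted_identity by simp
  then show ?thesis
    using integral_powr_pos by (simp add: zero_le_mult_iff)
qed

text \<open>In the weighted identity the integral on the right is at most
  \<open>2 * (p - 1)\<close>, the interval having length 2, and the one on the left is at least
  \<open>tent_mass\<close>.\<close>

lemma lam_le:
  assumes "p \<le> 2"
  shows "lam \<le> pi\<^sup>2 / 4 + pi\<^sup>2 / 2 / tent_mass * (p - 1)"
proof -
  have "integral {-1..1} (\<lambda>t. (v t - v t powr p) * phi1 t) \<le> integral {-1..1} (\<lambda>t::real. (p - 1) * 1)"
  proof (rule integral_le)
    show "(\<lambda>t. (v t - v t powr p) * phi1 t) integrable_on {-1..1}"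
      using p by (intro integrable_continuous_real continuous_intros cont_v cont_v_powr) auto
    fix t :: real assume t: "t \<in> {-1..1}"
    show "(v t - v t powr p) * phi1 t \<le> (p - 1) * 1"
      using diff_powr_bounds[of "v t" p] v_nonneg[OF t] v_le_1[OF t] phi1_nonneg[OF t] phi1_le_1[of t] p
      by (intro mult_mono) auto
  qed auto
  then have up: "integral {-1..1} (\<lambda>t. (v t - v t powr p) * phi1 t) \<le> 2 * (p - 1)"
    by simp
  have "tent_mass \<le> integral {-1..1} (\<lambda>t. v t powr p * phi1 t)"
    unfolding tent_mass_def
  proof (rule integral_le)
    show "(\<lambda>t. v t powr p * phi1 t) integrable_on {-1..1}"
      using p by (intro integrable_continuous_real continuous_intros cont_v_powr) auto
    show "(\<lambda>t. ((1 - \<bar>t\<bar>) / 2)\<^sup>2 * phi1 t) integrable_on {-1..1}"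
      by (intro integrable_continuous_real continuous_intros) auto
    fix t :: real assume t: "t \<in> {-1..1}"
    have "((1 - \<bar>t\<bar>) / 2)\<^sup>2 \<le> (v t)\<^sup>2"
      using t v_ge_tent[OF t] by (intro power_mono) auto
    also have "(v t)\<^sup>2 = v t powr 2"
      using v_nonneg[OF t] by simp
    also have "v t powr 2 \<le> v t powr p"
      using assms v_nonneg[OF t] v_le_1[OF t] by (intro powr_mono') auto
    finally show "((1 - \<bar>t\<bar>) / 2)\<^sup>2 * phi1 t \<le> v t powr p * phi1 t"
      using phi1_nonneg[OF t] by (intro mult_right_mono)
  qed
  then have "(lam - pi\<^sup>2 / 4) * tent_mass \<le> (lam - pi\<^sup>2 / 4) * integral {-1..1} (\<lambda>t. v t powr p * phi1 t)"
    using lam_ge by (intro mult_left_mono) auto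
  also have "\<dots> \<le> pi\<^sup>2 / 4 * (2 * (p - 1))"
    unfolding weighted_identity using up by (intro mult_left_mono) auto
  finally show ?thesis
    using tent_mass_pos by (simp add: field_simps)
qed

lemma lam_approx:
  assumes "p \<le> 2"
  shows "\<bar>lam - pi\<^sup>2 / 4\<bar> \<le> resid_const * (p - 1)"
proof -
  have "pi\<^sup>2 / 4 * (p - 1) \<ge> 0"
    using p by simp
  then show ?thesis
    using lam_le[OF assms] lam_ge by (simp add: resid_const_def distrib_right)
qed

text \<open>This is the residual of \<open>v\<close> in the limit equation. It splits into
  \<open>pi^2 / 4 * (v - v powr p)\<close> minus \<open>(lam - pi^2 / 4) * v powr p\<close>, and the
  two bounds add up to \<open>resid_const * (p - 1)\<close>.\<close>

lemma residual_bound: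
  assumes "p \<le> 2" and t: "t \<in> {-1..1}"
  shows "\<bar>pi\<^sup>2 / 4 * v t - lam * v t powr p\<bar> \<le> resid_const * (p - 1)"
proof -
  have b: "0 \<le> v t - v t powr p" "v t - v t powr p \<le> p - 1" "0 \<le> v t powr p" "v t powr p \<le> 1"
    using diff_powr_bounds[of "v t" p] v_nonneg[OF t] v_le_1[OF t] p by auto
  have 1: "pi\<^sup>2 / 4 * (v t - v t powr p) \<le> pi\<^sup>2 / 4 * (p - 1)" "0 \<le> pi\<^sup>2 / 4 * (v t - v t powr p)"
    using b by (auto intro!: mult_left_mono)
  have 2: "(lam - pi\<^sup>2 / 4) * v t powr p \<le> (lam - pi\<^sup>2 / 4) * 1" "0 \<le> (lam - pi\<^sup>2 / 4) * v t powr p"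
    using b lam_ge mult_left_mono[of "v t powr p" 1 "lam - pi\<^sup>2 / 4"] by simp_all
  have "w * v t - lam * v t powr p = w * (v t - v t powr p) - (lam - w) * v t powr p" for w
    by (simp add: algebra_simps)
  from this[of "pi\<^sup>2 / 4"]
  have "pi\<^sup>2 / 4 * v t - lam * v t powr p
      = pi\<^sup>2 / 4 * (v t - v t powr p) - (lam - pi\<^sup>2 / 4) * v t powr p" .
  moreover have "resid_const * (p - 1) = pi\<^sup>2 / 4 * (p - 1) + pi\<^sup>2 / 2 / tent_mass * (p - 1)"
    by (simp add: resid_const_def distrib_right)
  moreover have "(lam - pi\<^sup>2 / 4) * v t powr p \<le> pi\<^sup>2 / 2 / tent_mass * (p - 1)"
    using 2(1) lam_le[OF assms(1)] by (simp add: diff_le_eq)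
  moreover have "\<bar>a - b\<bar> \<le> x + y" if "0 \<le> a" "a \<le> x" "0 \<le> b" "b \<le> y" for a b x y :: real
    using that by linarith
  ultimately show ?thesis
    using 1 2 by presburger
qed

text \<open>
  Variation of constants around the maximum point: the two auxiliary functions of \<open>s\<close> below have
  derivatives \<open>e s * sin (pi / 2 * (t - s))\<close> and \<open>e s * cos (pi / 2 * (t - s))\<close>, where
  \<open>e = v'' + (pi / 2)\<^sup>2 * v\<close> is the residual.
\<close>

lemma approx_shifted:
  assumes p2: "p \<le> 2" and t: "t \<in> {-1..1}"
  shows "\<bar>v t - cos (pi / 2 * (t - t0))\<bar> \<le> 2 * resid_const * (p - 1)"
    and "\<bar>v' t + pi / 2 * sin (pi / 2 * (t - t0))\<bar> \<le> 2 * resid_const * (p - 1)"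
proof -
  define e where "e = (\<lambda>s. pi\<^sup>2 / 4 * v s - lam * v s powr p)"
  define R where "R = resid_const * (p - 1)"
  have R: "R \<ge> 0"
    using resid_const_pos p by (simp add: R_def)
  have e: "\<bar>e s\<bar> \<le> R" if "s \<in> {-1..1}" for s
    unfolding e_def R_def using p2 that by (rule residual_bound)
  define G where "G = (\<lambda>s. v s * (pi / 2) * cos (pi / 2 * (t - s)) + v' s * sin (pi / 2 * (t - s)))"
  define H where "H = (\<lambda>s. v' s * cos (pi / 2 * (t - s)) - v s * (pi / 2) * sin (pi / 2 * (t - s)))"
  have dG: "(G has_real_derivative e s * sin (pi / 2 * (t - s))) (at s within {-1..1})"
    if "s \<in> {-1..1}" for s
    unfolding G_def
    by (rule derivative_eq_intros dv[OF that] dv'[OF that] refl)+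
      (simp add: e_def algebra_simps power2_eq_square)
  have dH: "(H has_real_derivative e s * cos (pi / 2 * (t - s))) (at s within {-1..1})"
    if "s \<in> {-1..1}" for s
    unfolding H_def
    by (rule derivative_eq_intros dv[OF that] dv'[OF that] refl)+
      (simp add: e_def algebra_simps power2_eq_square)
  have "\<bar>e s\<bar> * \<bar>sin x\<bar> \<le> R" "\<bar>e s\<bar> * \<bar>cos x\<bar> \<le> R" if "s \<in> {-1..1}" for s x
    using mult_mono[OF e[OF that] abs_sin_le_one[of x]] mult_mono[OF e[OF that] abs_cos_le_one[of x]] R
    by simp_all
  then have "\<bar>G t - G t0\<bar> \<le> R * \<bar>t - t0\<bar>" "\<bar>H t - H t0\<bar> \<le> R * \<bar>t - t0\<bar>"
    using field_differentiable_bound[of "{-1..1}" G _ R t t0, OF _ dG]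
      field_differentiable_bound[of "{-1..1}" H _ R t t0, OF _ dH] t t0
    by (simp_all add: abs_mult)
  moreover have "R * \<bar>t - t0\<bar> \<le> R * 2"
    using R t t0 by (intro mult_left_mono) auto
  ultimately have GH: "\<bar>G t - G t0\<bar> \<le> 2 * R" "\<bar>H t - H t0\<bar> \<le> 2 * R"
    by linarith+
  \<comment> \<open>At \<open>s = t\<close> the trigonometric factors are 1 and 0; at
    \<open>s = t0\<close> the data \<open>v t0 = 1\<close> and \<open>v' t0 = 0\<close> leave a
    single cosine, and for \<open>H\<close> a single sine.\<close>
  have "G t - G t0 = pi / 2 * (v t - cos (pi / 2 * (t - t0)))"
    using t0 by (simp add: G_def algebra_simps)
  with GH have "pi / 2 * \<bar>v t - cos (pi / 2 * (t - t0))\<bar> \<le> 2 * R"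
    by (simp add: abs_mult)
  moreover have "1 * \<bar>v t - cos (pi / 2 * (t - t0))\<bar> \<le> pi / 2 * \<bar>v t - cos (pi / 2 * (t - t0))\<bar>"
    using pi_ge_two by (intro mult_right_mono) auto
  ultimately show "\<bar>v t - cos (pi / 2 * (t - t0))\<bar> \<le> 2 * resid_const * (p - 1)"
    by (simp add: R_def)
  have "H t - H t0 = v' t + pi / 2 * sin (pi / 2 * (t - t0))"
    using t0 by (simp add: H_def)
  with GH show "\<bar>v' t + pi / 2 * sin (pi / 2 * (t - t0))\<bar> \<le> 2 * resid_const * (p - 1)"
    by (simp add: R_def)
qed

text \<open>At \<open>t = 1\<close> the solution vanishes, while the shifted cosine approximating it
  takes the value \<open>sin (pi / 2 * t0)\<close>. This is what forces the maximum point towards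
  0.\<close>

lemma sin_t0_bound:
  assumes "p \<le> 2"
  shows "\<bar>sin (pi / 2 * t0)\<bar> \<le> 2 * resid_const * (p - 1)"
proof -
  have "cos (pi / 2 * (1 - t0)) = sin (pi / 2 * t0)"
    by (simp add: sin_cos_eq right_diff_distrib)
  then show ?thesis
    using approx_shifted(1)[OF assms, of 1] v_ends by simp
qed

text \<open>For a nonnegative cosine,
  \<open>1 = sin^2 + cos^2 \<le> \<bar>sin\<bar> + cos\<close>.\<close>

lemma cos_t0_bound: "0 \<le> 1 - cos (pi / 2 * t0)" "1 - cos (pi / 2 * t0) \<le> \<bar>sin (pi / 2 * t0)\<bar>"
proof -
  define x where "x = pi / 2 * t0"
  have c: "0 \<le> cos x" "cos x \<le> 1"
    using phi1_nonneg[of t0] t0 by (auto simp: phi1_def x_def)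
  then show "0 \<le> 1 - cos (pi / 2 * t0)"
    by (simp add: x_def)
  have "cos x * cos x \<le> cos x * 1"
    using c by (intro mult_left_mono) auto
  moreover have "\<bar>sin x\<bar> * \<bar>sin x\<bar> \<le> \<bar>sin x\<bar> * 1"
    by (intro mult_left_mono) auto
  moreover have "\<bar>sin x\<bar> * \<bar>sin x\<bar> + cos x * cos x = 1"
    using sin_cos_squared_add[of x] by (simp add: power2_eq_square)
  ultimately show "1 - cos (pi / 2 * t0) \<le> \<bar>sin (pi / 2 * t0)\<bar>"
    unfolding x_def[symmetric] by linarith
qed

text \<open>The addition formulas bound both differences by the sum of
  \<open>1 - cos (pi / 2 * t0)\<close> and \<open>\<bar>sin (pi / 2 * t0)\<bar>\<close>, hence by
  twice the latter.\<close>

lemma shift_bounds: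
  assumes "p \<le> 2"
  shows "\<bar>cos (pi / 2 * (t - t0)) - cos (pi / 2 * t)\<bar> \<le> 4 * resid_const * (p - 1)"
    and "\<bar>sin (pi / 2 * (t - t0)) - sin (pi / 2 * t)\<bar> \<le> 4 * resid_const * (p - 1)"
proof -
  let ?x = "pi / 2 * t" and ?y = "pi / 2 * t0"
  have b: "\<bar>x * (cos ?y - 1)\<bar> \<le> \<bar>sin ?y\<bar>" "\<bar>x * sin ?y\<bar> \<le> \<bar>sin ?y\<bar>" if "\<bar>x\<bar> \<le> 1" for x
    using mult_right_mono[OF that, of "\<bar>cos ?y - 1\<bar>"] mult_right_mono[OF that, of "\<bar>sin ?y\<bar>"]
      cos_t0_bound by (simp_all add: abs_mult)
  have "cos (?x - ?y) - cos ?x = cos ?x * (cos ?y - 1) + sin ?x * sin ?y"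
    and "sin (?x - ?y) - sin ?x = sin ?x * (cos ?y - 1) - cos ?x * sin ?y"
    by (simp_all add: cos_diff sin_diff algebra_simps)
  then have "\<bar>cos (?x - ?y) - cos ?x\<bar> \<le> 2 * \<bar>sin ?y\<bar>" "\<bar>sin (?x - ?y) - sin ?x\<bar> \<le> 2 * \<bar>sin ?y\<bar>"
    using b[of "cos ?x"] b[of "sin ?x"] abs_cos_le_one[of ?x] abs_sin_le_one[of ?x] by linarith+
  then show "\<bar>cos (pi / 2 * (t - t0)) - cos (pi / 2 * t)\<bar> \<le> 4 * resid_const * (p - 1)"
    "\<bar>sin (pi / 2 * (t - t0)) - sin (pi / 2 * t)\<bar> \<le> 4 * resid_const * (p - 1)"
    using sin_t0_bound[OF assms] unfolding right_diff_distrib by linarith+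
qed

text \<open>Moving the centre from \<open>t0\<close> to 0 adds 4 to the constant 2 of the shifted
  estimate. The constant 10 is chosen to serve for the derivative as well, where the factor
  \<open>pi / 2 \<le> 2\<close> turns 4 into 8.\<close>

lemma v_approx:
  assumes "p \<le> 2" "t \<in> {-1..1}"
  shows "\<bar>v t - phi1 t\<bar> \<le> 10 * resid_const * (p - 1)"
proof -
  have "0 \<le> resid_const * (p - 1)"
    using resid_const_pos p by simp
  then show ?thesis
    using approx_shifted(1)[OF assms] shift_bounds(1)[OF assms(1), of t]
    unfolding phi1_def by linarith
qed

lemma v'_approx:
  assumes "p \<le> 2" "t \<in> {-1..1}"
  shows "\<bar>v' t - - (pi / 2 * sin (pi / 2 * t))\<bar> \<le> 10 * resid_const * (p - 1)"
proof -
  have "pi / 2 * \<bar>sin (pi / 2 * (t - t0)) - sin (pi / 2 * t)\<bar> \<le> 2 * (4 * resid_const * (p - 1))"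
    using pi_less_4 shift_bounds(2)[OF assms(1), of t] by (intro mult_mono) auto
  moreover have "\<bar>pi / 2 * sin (pi / 2 * (t - t0)) - pi / 2 * sin (pi / 2 * t)\<bar>
      = pi / 2 * \<bar>sin (pi / 2 * (t - t0)) - sin (pi / 2 * t)\<bar>"
    by (simp only: right_diff_distrib[symmetric] abs_mult) simp
  ultimately have "\<bar>pi / 2 * sin (pi / 2 * (t - t0)) - pi / 2 * sin (pi / 2 * t)\<bar>
      \<le> 8 * resid_const * (p - 1)"
    by linarith
  then show ?thesis
    using approx_shifted(2)[OF assms] by linarith
qed

text \<open>The mean value theorem gives the sign of \<open>v'\<close> somewhere on each side of
  \<open>t0\<close>, and monotonicity of \<open>v'\<close> carries it to the end point. These slopes
  fix the signs needed for shooting.\<close>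

lemma v'_ends: "v' (-1) > 0" "v' 1 < 0"
proof -
  obtain x where x: "-1 < x" "x < t0" "v t0 - v (-1) = (t0 - -1) * v' x"
    using v_mvt[of "-1" t0] t0 by auto
  then have "(t0 + 1) * v' x > 0"
    using t0 v_ends by simp
  then have "v' x > 0"
    using t0 by (auto simp: zero_less_mult_iff)
  then show "v' (-1) > 0"
    using v'_antimono[of "-1" x] x t0 by auto
  obtain y where y: "t0 < y" "y < 1" "v 1 - v t0 = (1 - t0) * v' y"
    using v_mvt[of t0 1] t0 by auto
  then have "(1 - t0) * v' y < 0"
    using t0 v_ends by simp
  then have "v' y < 0"
    using t0 by (auto simp: mult_less_0_iff)
  then show "v' 1 < 0"
    using v'_antimono[of y 1] y t0 by auto
qed

text \<open>
  The function \<open>y\<close> in the proof is the derivative of the family of rescaled solutions that all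
  vanish at the left end point.
\<close>

lemma linearized_eigenvalue_nonpos:
  obtains \<mu> where "\<mu> \<le> 0" "dirichlet_eigenvalue (\<lambda>t. p * lam * v t powr (p - 1)) \<mu>"
proof (rule dirichlet_eigenvalue_nonpos_exists)
  \<comment> \<open>The scaling exponent: \<open>k powr c * v (k * (t + 1) - 1)\<close> solves the
    same equation as \<open>v\<close> exactly because \<open>c + 2 = p * c\<close>. Differentiating
    in \<open>k\<close> at \<open>k = 1\<close> gives \<open>?y\<close>.\<close>
  define c where "c = 2 / (p - 1)"
  have c: "c > 0" "c * (p - 1) = 2"
    using p by (simp_all add: c_def field_simps)
  let ?y = "\<lambda>t. (t + 1) * v' t + c * v t"
  let ?y' = "\<lambda>t. (1 + c) * v' t - (t + 1) * (lam * v t powr p)"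
  show "continuous_on {-1..1} (\<lambda>t. p * lam * v t powr (p - 1))"
    using p by (intro continuous_intros cont_v_powr) auto
  show "continuous_on {-1..1} ?y" "continuous_on {-1..1} ?y'"
    using p by (intro continuous_intros cont_v_powr cont_v cont_v'; simp)+
  show "?y (-1) = 0" "?y' (-1) > 0" "?y 1 < 0"
    using v_ends v'_ends c by auto
  fix t :: real assume t: "t \<in> {-1<..<1}"
  have d: "(v has_real_derivative v' t) (at t)"
    and d': "(v' has_real_derivative - (lam * v t powr p)) (at t)"
    using dv[of t] dv'[of t] t by (auto simp: at_within_Icc_at)
  have d'': "((\<lambda>t. v t powr p) has_real_derivative p * v t powr (p - 1) * v' t) (at t)"
    using DERIV_fun_powr[OF d v_pos[OF t], of p] by simp
  show "(?y has_real_derivative ?y' t) (at t)"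
    by (rule derivative_eq_intros d d' refl)+ (simp add: algebra_simps)
  have pw: "v t powr p = v t powr (p - 1) * v t"
    using v_pos[OF t] by (simp add: powr_diff)
  have "(?y' has_real_derivative (1 + c) * - (lam * v t powr p)
      - (lam * v t powr p + (t + 1) * (lam * (p * v t powr (p - 1) * v' t)))) (at t)"
    by (rule derivative_eq_intros d d' d'' refl)+ simp
  moreover have "(1 + c) * - (lam * v t powr p)
      - (lam * v t powr p + (t + 1) * (lam * (p * v t powr (p - 1) * v' t)))
      = - (p * lam * v t powr (p - 1) * ?y t)"
  proof -
    have "(1 + c) * - L - (L + X) = - ((2 + c) * L) - X" for L X :: real
      by (simp add: algebra_simps)
    moreover have "2 + c = p * c"
      using c by (simp add: algebra_simps)
    ultimately have eq: "(1 + c) * - L - (L + X) = - (p * c * L) - X" for L X :: real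
      by simp
    show ?thesis
      unfolding eq pw by (simp add: algebra_simps)
  qed
  ultimately show "(?y' has_real_derivative - (p * lam * v t powr (p - 1) * ?y t)) (at t)"
    by simp
qed (rule that)

end

section \<open>The limit as p tends to 1\<close>

text \<open>With \<open>M\<close> the maximum of \<open>u\<close>, the value of \<open>lam\<close>
  comes from \<open>M powr (p - 1) * (u / M) powr p = u powr p / M\<close>. Positivity of
  \<open>M\<close> and the boundary values put the maximum point in the interior, where the
  derivative vanishes.\<close>

lemma positive_solution_normalized:
  assumes p: "1 < p" and u: "positive_solution p u"
  shows "0 < sup_norm u"
    and "\<exists>t0 v'. normalized_solution p (sup_norm u powr (p - 1)) t0 (\<lambda>t. u t / sup_norm u) v'"
proof -
  have sol: "dirichlet_solution (\<lambda>t. u t powr p) u" and pos: "\<And>t. t \<in> {-1<..<1} \<Longrightarrow> u t > 0"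
    using u by (auto simp: positive_solution_def)
  have cont: "continuous_on {-1..1} u" and ends: "u (-1) = 0" "u 1 = 0"
    using sol by (auto simp: dirichlet_solution_def)
  have nonneg: "u t \<ge> 0" if "t \<in> {-1..1}" for t
    using that pos[of t] ends by (cases "t = -1 \<or> t = 1") (auto simp: less_eq_real_def)
  have "continuous_on {-1..1} (\<lambda>t. u t powr p)"
    using p nonneg by (intro continuous_on_powr' cont continuous_intros) auto
  with sol obtain u' where
      du: "\<And>t. t \<in> {-1..1} \<Longrightarrow> (u has_real_derivative u' t) (at t within {-1..1})"
    and du': "\<And>t. t \<in> {-1..1} \<Longrightarrow> (u' has_real_derivative - (u t powr p)) (at t within {-1..1})"
    using dirichlet_solution_C2 by blast
  obtain t0 where t0: "t0 \<in> {-1..1}" and max: "\<And>t. t \<in> {-1..1} \<Longrightarrow> u t \<le> u t0"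
    using continuous_attains_sup[OF _ _ cont] by auto
  define M where "M = sup_norm u"
  have M: "M = u t0"
    unfolding M_def sup_norm_def using t0 max nonneg
    by (intro cSup_eq_maximum) (auto intro!: image_eqI[of _ _ t0])
  have "0 < u 0" "u 0 \<le> u t0"
    using pos[of 0] max[of 0] by auto
  then have Mpos: "M > 0"
    unfolding M by linarith
  then show "0 < sup_norm u"
    by (simp add: M_def)
  have "t0 \<noteq> -1" "t0 \<noteq> 1"
    using Mpos ends by (auto simp: M)
  with t0 have t0': "t0 \<in> {-1<..<1}"
    by auto
  have "u' t0 = 0"
  proof (rule DERIV_local_max)
    show "(u has_real_derivative u' t0) (at t0)"
      using du[OF t0] t0' by (simp add: at_within_Icc_at)
    show "min (t0 + 1) (1 - t0) > 0"
      using t0' by auto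
    show "\<forall>y. \<bar>t0 - y\<bar> < min (t0 + 1) (1 - t0) \<longrightarrow> u y \<le> u t0"
      using max by (auto simp: abs_if split: if_splits)
  qed
  have scale: "M powr (p - 1) * (u t / M) powr p = u t powr p / M" if "t \<in> {-1..1}" for t
    using Mpos nonneg[OF that] by (simp add: powr_divide powr_diff)
  have "normalized_solution p (M powr (p - 1)) t0 (\<lambda>t. u t / M) (\<lambda>t. u' t / M)"
  proof
    fix t :: real assume t: "t \<in> {-1..1}"
    show "((\<lambda>t. u t / M) has_real_derivative u' t / M) (at t within {-1..1})"
      using du[OF t] by (rule DERIV_cdivide)
    show "((\<lambda>t. u' t / M) has_real_derivative - (M powr (p - 1) * (u t / M) powr p)) (at t within {-1..1})"
      using DERIV_cdivide[OF du'[OF t], of M] scale[OF t] by simp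
    show "u t / M \<le> 1"
      using max[OF t] Mpos by (simp add: M)
    show "0 \<le> u t / M"
      using nonneg[OF t] Mpos by simp
  next
    show "u t0 / M = 1" "0 < M powr (p - 1)"
      using Mpos by (simp_all add: M)
  qed (use p Mpos ends t0' \<open>u' t0 = 0\<close> pos in auto)
  then show "\<exists>t0 v'. normalized_solution p (sup_norm u powr (p - 1)) t0 (\<lambda>t. u t / sup_norm u) v'"
    unfolding M_def by blast
qed

lemma dirichlet_eigenvalue_cong:
  assumes "\<And>t. t \<in> {-1<..<1} \<Longrightarrow> q t = q' t"
  shows "dirichlet_eigenvalue q \<mu> \<longleftrightarrow> dirichlet_eigenvalue q' \<mu>"
  unfolding dirichlet_eigenvalue_def dirichlet_solution_def using assms by simp

section \<open>Uniform limits, integrals and the constant \<open>c_tilde\<close>\<close>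

lemma uniform_limit_real_bound:
  fixes f :: "'a \<Rightarrow> 'b \<Rightarrow> real"
  assumes "\<forall>\<^sub>F x in F. \<forall>t\<in>S. \<bar>f x t - g t\<bar> \<le> h x" and "(h \<longlongrightarrow> 0) F"
  shows "uniform_limit S f g F"
proof (rule uniform_limitI)
  fix e :: real assume "e > 0"
  with assms(2) have "\<forall>\<^sub>F x in F. h x < e"
    by (rule order_tendstoD)
  with assms(1) show "\<forall>\<^sub>F x in F. \<forall>t\<in>S. dist (f x t) (g t) < e"
    by eventually_elim (auto simp: dist_real_def intro: le_less_trans)
qed

lemma tendsto_integral_uniform_limit:
  fixes f :: "'a \<Rightarrow> real \<Rightarrow> real"
  assumes lim: "uniform_limit {a..b} f g F" and cont: "\<forall>\<^sub>F x in F. continuous_on {a..b} (f x)"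
    and "F \<noteq> bot"
  shows "((\<lambda>x. integral {a..b} (f x)) \<longlongrightarrow> integral {a..b} g) F"
proof -
  \<comment> \<open>Continuity is known only eventually; replacing the other members by 0 makes it
    hold at every index and does not affect the limit.\<close>
  define f2 where "f2 = (\<lambda>x. if continuous_on {a..b} (f x) then f x else (\<lambda>_. 0))"
  have eq: "\<forall>\<^sub>F x in F. f x = f2 x"
    using cont by eventually_elim (simp add: f2_def)
  have "uniform_limit {a..b} f2 g F"
    using lim by (rule uniform_limit_cong[THEN iffD1, rotated 2])
      (use eq in \<open>auto elim: eventually_mono\<close>)
  moreover have "continuous_on {a..b} (f2 x)" for x
    by (simp add: f2_def)
  ultimately obtain I J where I: "\<And>x. (f2 x has_integral I x) {a..b}"
    and J: "(g has_integral J) {a..b}" and "(I \<longlongrightarrow> J) F"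
    using \<open>F \<noteq> bot\<close> by (metis uniform_limit_integral)
  moreover have "\<forall>\<^sub>F x in F. I x = integral {a..b} (f x)"
    using eq by eventually_elim (simp add: integral_unique[OF I])
  ultimately show ?thesis
    unfolding integral_unique[OF J] by (simp add: tendsto_cong)
qed

lemma tendsto_minus_1_at_right: "((\<lambda>p::real. c * (p - 1)) \<longlongrightarrow> 0) (at_right 1)"
  by (auto intro!: tendsto_eq_intros)

lemma eventually_at_right_1: "\<forall>\<^sub>F p in at_right (1::real). 1 < p \<and> p \<le> 2"
  unfolding eventually_at_right_field by (auto intro: exI[of _ 2])

lemma uniform_limit_diff_powr_quotient:
  "uniform_limit {0..1} (\<lambda>p s. (s - s powr p) / (p - 1)) (\<lambda>s. s * - ln s :: real) (at_right 1)"
proof (rule uniform_limit_real_bound[OF _ tendsto_minus_1_at_right[of 1]])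
  show "\<forall>\<^sub>F p in at_right 1. \<forall>s\<in>{0..1}. \<bar>(s - s powr p) / (p - 1) - s * - ln s\<bar> \<le> 1 * (p - 1 :: real)"
    using eventually_at_right_1
  proof eventually_elim
    case (elim p)
    then show ?case
      using diff_powr_quotient_approx[of _ p] by auto
  qed
qed

text \<open>As a uniform limit of continuous functions it is continuous also at 0, where
  \<open>ln 0 = 0\<close> gives the value 0.\<close>

lemma continuous_on_neg_x_ln_x: "continuous_on {0..1} (\<lambda>s::real. s * - ln s)"
proof (rule uniform_limit_theorem[OF _ uniform_limit_diff_powr_quotient])
  show "\<forall>\<^sub>F p in at_right 1. continuous_on {0..1} (\<lambda>s::real. (s - s powr p) / (p - 1))"
    using eventually_at_right_1
    by eventually_elim (auto intro!: continuous_intros continuous_on_powr')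
qed (simp add: trivial_limit_at_right_real)

lemma phi1_sq_ln: "t \<in> {-1..1} \<Longrightarrow> (phi1 t)\<^sup>2 * \<bar>ln (phi1 t)\<bar> = (phi1 t * - ln (phi1 t)) * phi1 t"
  using phi1_nonneg[of t] phi1_le_1[of t]
  by (cases "phi1 t = 0") (auto simp: power2_eq_square abs_if)

lemma continuous_on_phi1_ln: "continuous_on {-1..1} (\<lambda>t. (phi1 t * - ln (phi1 t)) * phi1 t)"
  by (intro continuous_intros continuous_on_compose2[OF continuous_on_neg_x_ln_x continuous_on_phi1])
    (use phi1_nonneg phi1_le_1 in auto)

lemma c_tilde_eq:
  "c_tilde = integral {-1..1} (\<lambda>t. (phi1 t * - ln (phi1 t)) * phi1 t) / integral {-1..1} (\<lambda>t. phi1 t * phi1 t)"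
  unfolding c_tilde_def power2_eq_square[symmetric, of "phi1 _"]
  by (subst integral_cong[OF phi1_sq_ln]) auto

lemma phi1_integrals_pos:
  "integral {-1..1} (\<lambda>t. phi1 t * phi1 t) > 0"
  "integral {-1..1} (\<lambda>t. (phi1 t * - ln (phi1 t)) * phi1 t) > 0"
proof -
  have pos: "integral {-1..1} f > 0"
    if cont: "continuous_on {-1..1} f" and nonneg: "\<And>t. t \<in> {-1..1} \<Longrightarrow> f t \<ge> 0" and nz: "f (1/2) > 0"
    for f :: "real \<Rightarrow> real"
  proof -
    have "\<not> (\<forall>t\<in>{-1..1}. f t = 0)"
      using nz by (auto intro!: bexI[of _ "1/2"])
    then have "integral {-1..1} f \<noteq> 0"
      using integral_eq_0_iff[OF cont _ nonneg] by auto
    moreover have "integral {-1..1} f \<ge> 0"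
      using nonneg by (intro integral_nonneg integrable_continuous_real cont) auto
    ultimately show ?thesis by simp
  qed
  \<comment> \<open>The test point 1/2 avoids 0, where \<open>phi1\<close> equals 1 and its
    logarithm vanishes.\<close>
  have half: "0 < phi1 (1/2)" "phi1 (1/2) < 1"
  proof -
    show "0 < phi1 (1/2)" by (rule phi1_pos) auto
    have "cos (pi / 4) < cos 0"
      by (intro cos_monotone_0_pi) auto
    then show "phi1 (1/2) < 1" by (simp add: phi1_def)
  qed
  show "integral {-1..1} (\<lambda>t. phi1 t * phi1 t) > 0"
    using half by (intro pos continuous_intros) auto
  show "integral {-1..1} (\<lambda>t. (phi1 t * - ln (phi1 t)) * phi1 t) > 0"
  proof (rule pos[OF continuous_on_phi1_ln])
    show "0 \<le> (phi1 t * - ln (phi1 t)) * phi1 t" if "t \<in> {-1..1}" for t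
      unfolding phi1_sq_ln[OF that, symmetric] by simp
    show "0 < (phi1 (1/2) * - ln (phi1 (1/2))) * phi1 (1/2)"
      using half by (intro mult_pos_pos) (auto simp: ln_less_zero)
  qed
qed

lemma c_tilde_pos: "c_tilde > 0"
  unfolding c_tilde_eq using phi1_integrals_pos(2,1) by (rule divide_pos_pos)

theorem theorem1p2:
  fixes u :: "real \<Rightarrow> real \<Rightarrow> real" and \<alpha>\<^sub>1 :: "real \<Rightarrow> real"
  assumes u: "\<And>p. p > 1 \<Longrightarrow> positive_solution p (u p)"
    and \<alpha>\<^sub>1: "\<And>p. p > 1 \<Longrightarrow> first_dirichlet_eigenvalue (\<lambda>t. p * u p t powr (p - 1)) (\<alpha>\<^sub>1 p)"
  shows "((\<lambda>p. sup_norm (u p) powr (p - 1) - (pi\<^sup>2 / 4 + pi\<^sup>2 / 4 * c_tilde * (p - 1)))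
            \<in> o[at_right 1](\<lambda>p. p - 1) \<and> c_tilde > 0) \<and>
         C1_limit {-1..1} (\<lambda>p t. u p t / sup_norm (u p)) phi1 (at_right 1) \<and>
         C1_loc_limit {-1<..<1} (\<lambda>p t. p * u p t powr (p - 1)) (\<lambda>t. pi\<^sup>2 / 4) (at_right 1) \<and>
         (\<alpha>\<^sub>1 \<longlongrightarrow> 0) (at_right 1)"
proof -

  \<comment> \<open>The normalized solutions and their limits\<close>
  define lam where "lam = (\<lambda>p. sup_norm (u p) powr (p - 1))"
  define v where "v = (\<lambda>p t. u p t / sup_norm (u p))"
  define K where "K = 10 * resid_const"
  have "\<exists>t0 v'. normalized_solution p (lam p) t0 (v p) v'" if "p > 1" for p
    unfolding lam_def v_def using positive_solution_normalized(2)[OF that u[OF that]] .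
  then obtain t0 v' where "\<And>p. p > 1 \<Longrightarrow> normalized_solution p (lam p) (t0 p) (v p) (v' p)"
    by metis
  note ns = normalized_solution.v_nonneg[OF this] normalized_solution.v_le_1[OF this]
      normalized_solution.v_pos[OF this] normalized_solution.dv[OF this]
      normalized_solution.cont_v[OF this] normalized_solution.cont_v'[OF this]
      normalized_solution.cont_v_powr[OF this] normalized_solution.lam[OF this]
    and identity = normalized_solution.weighted_identity[OF this]
    and eigenvalue = normalized_solution.linearized_eigenvalue_nonpos[OF this]
    and approx = normalized_solution.v_approx[OF this, folded K_def]
      normalized_solution.v'_approx[OF this, folded K_def] normalized_solution.lam_approx[OF this]
  have K: "K > 0"
    using resid_const_pos by (simp add: K_def)
  have potential: "p * u p t powr (p - 1) = p * lam p * v p t powr (p - 1)"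
    if "p > 1" "t \<in> {-1..1}" for p t
  proof -
    have "0 < sup_norm (u p)"
      using positive_solution_normalized(1)[OF that(1) u[OF that(1)]] .
    moreover from this have "u p t \<ge> 0"
      using ns(1)[OF that] by (simp add: v_def zero_le_divide_iff)
    ultimately show ?thesis
      by (simp add: lam_def v_def powr_divide)
  qed
  have lim_p: "((\<lambda>p. p) \<longlongrightarrow> 1) (at_right (1::real))"
    by (rule tendsto_ident_at)
  have lim_lam: "(lam \<longlongrightarrow> pi\<^sup>2 / 4) (at_right 1)"
  proof (rule LIM_zero_cancel, rule Lim_null_comparison[OF _ tendsto_minus_1_at_right])
    show "\<forall>\<^sub>F p in at_right 1. norm (lam p - pi\<^sup>2 / 4) \<le> resid_const * (p - 1)"
      using eventually_at_right_1 by eventually_elim (use approx(3) in auto)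
  qed
  have lim_plam: "((\<lambda>p. p * lam p) \<longlongrightarrow> pi\<^sup>2 / 4) (at_right 1)"
    using tendsto_mult[OF lim_p lim_lam] by simp
  have lim_v: "uniform_limit {-1..1} v phi1 (at_right 1)"
  proof (rule uniform_limit_real_bound[OF _ tendsto_minus_1_at_right])
    show "\<forall>\<^sub>F p in at_right 1. \<forall>t\<in>{-1..1}. \<bar>v p t - phi1 t\<bar> \<le> K * (p - 1)"
      using eventually_at_right_1 by eventually_elim (use approx(1) in auto)
  qed
  have lim_v': "uniform_limit {-1..1} v' (\<lambda>t. - (pi / 2 * sin (pi / 2 * t))) (at_right 1)"
  proof (rule uniform_limit_real_bound[OF _ tendsto_minus_1_at_right])
    show "\<forall>\<^sub>F p in at_right 1. \<forall>t\<in>{-1..1}. \<bar>v' p t - - (pi / 2 * sin (pi / 2 * t))\<bar> \<le> K * (p - 1)"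
      using eventually_at_right_1 by eventually_elim (use approx(2) in auto)
  qed

  \<comment> \<open>First-order expansion of the power of the sup norm\<close>
  have part1: "(\<lambda>p. lam p - (pi\<^sup>2 / 4 + pi\<^sup>2 / 4 * c_tilde * (p - 1))) \<in> o[at_right 1](\<lambda>p. p - 1)"
  proof (rule smalloI_tendsto)
    define A where "A = (\<lambda>p. integral {-1..1} (\<lambda>t. v p t powr p * phi1 t))"
    define D where "D = (\<lambda>p. integral {-1..1} (\<lambda>t. (v p t - v p t powr p) / (p - 1) * phi1 t))"
    have ev: "\<forall>\<^sub>F p in at_right (1::real). 1 < p"
      using eventually_at_right_1 by eventually_elim simp
    have "uniform_limit {-1..1} (\<lambda>p t. v p t powr p * phi1 t) (\<lambda>t. phi1 t * phi1 t) (at_right 1)"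
    proof (rule uniform_limit_real_bound[OF _ tendsto_minus_1_at_right])
      show "\<forall>\<^sub>F p in at_right 1. \<forall>t\<in>{-1..1}. \<bar>v p t powr p * phi1 t - phi1 t * phi1 t\<bar> \<le> (1 + K) * (p - 1)"
        using eventually_at_right_1
      proof (eventually_elim, intro ballI)
        fix p t :: real assume p: "1 < p \<and> p \<le> 2" and t: "t \<in> {-1..1}"
        \<comment> \<open>The triangle inequality through \<open>v p t\<close>: one term is the
          distance of \<open>v\<close> from its power, the other its distance from
          \<open>phi1\<close>.\<close>
        have "\<bar>v p t powr p - phi1 t\<bar> \<le> (p - 1) + K * (p - 1)"
          using diff_powr_bounds[of "v p t" p] ns(1,2)[of p t] approx(1)[of p t] p t by auto
        then have "\<bar>v p t powr p - phi1 t\<bar> * \<bar>phi1 t\<bar> \<le> ((p - 1) + K * (p - 1)) * 1"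
          using phi1_nonneg[OF t] phi1_le_1[of t] p K by (intro mult_mono) auto
        then show "\<bar>v p t powr p * phi1 t - phi1 t * phi1 t\<bar> \<le> (1 + K) * (p - 1)"
          by (simp add: abs_mult[symmetric] algebra_simps)
      qed
    qed
    then have A: "(A \<longlongrightarrow> integral {-1..1} (\<lambda>t. phi1 t * phi1 t)) (at_right 1)"
      unfolding A_def
    proof (rule tendsto_integral_uniform_limit)
      show "\<forall>\<^sub>F p in at_right 1. continuous_on {-1..1} (\<lambda>t. v p t powr p * phi1 t)"
        using ev by eventually_elim (intro continuous_intros ns; simp)
    qed (simp add: trivial_limit_at_right_real)
    \<comment> \<open>The limit function \<open>s * - ln s\<close> is uniformly continuous on
      [0, 1], so composing it with \<open>v p\<close> preserves the uniform convergence.\<close>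
    have h1: "uniform_limit {-1..1} (\<lambda>p t. v p t * - ln (v p t)) (\<lambda>t. phi1 t * - ln (phi1 t)) (at_right 1)"
    proof (rule uniform_limit_compose_uniformly_continuous_on[OF lim_v])
      show "uniformly_continuous_on {0..1} (\<lambda>s::real. s * - ln s)"
        using continuous_on_neg_x_ln_x by (intro compact_uniformly_continuous) auto
      show "\<forall>\<^sub>F p in at_right 1. \<forall>t\<in>{-1..1}. v p t \<in> {0..1}"
        using ev by eventually_elim (use ns(1,2) in auto)
    qed simp
    \<comment> \<open>The error of the difference quotient is at most \<open>p - 1\<close> for every
      \<open>s\<close> in [0, 1], so \<open>s\<close> may be replaced by
      \<open>v p t\<close>.\<close>
    have h2: "uniform_limit {-1..1} (\<lambda>p t. (v p t - v p t powr p) / (p - 1) - v p t * - ln (v p t)) (\<lambda>t. 0)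
        (at_right 1)"
    proof (rule uniform_limit_real_bound[OF _ tendsto_minus_1_at_right])
      show "\<forall>\<^sub>F p in at_right 1. \<forall>t\<in>{-1..1}.
          \<bar>(v p t - v p t powr p) / (p - 1) - v p t * - ln (v p t) - 0\<bar> \<le> 1 * (p - 1)"
        using ev
      proof (eventually_elim, intro ballI)
        fix p t :: real assume "1 < p" "t \<in> {-1..1}"
        then show "\<bar>(v p t - v p t powr p) / (p - 1) - v p t * - ln (v p t) - 0\<bar> \<le> 1 * (p - 1)"
          using diff_powr_quotient_approx[of "v p t" p] ns(1,2)[of p t] by simp
      qed
    qed
    have "uniform_limit {-1..1} (\<lambda>p t. (v p t - v p t powr p) / (p - 1)) (\<lambda>t. phi1 t * - ln (phi1 t)) (at_right 1)"
      using uniform_limit_add[OF h2 h1] by simp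
    then have "uniform_limit {-1..1} (\<lambda>p t. (v p t - v p t powr p) / (p - 1) * phi1 t)
        (\<lambda>t. (phi1 t * - ln (phi1 t)) * phi1 t) (at_right 1)"
    proof (rule uniform_lim_mult[OF _ uniform_limit_const])
      have "compact ((\<lambda>t. phi1 t * - ln (phi1 t)) ` {-1..1})"
        by (intro compact_continuous_image continuous_on_compose2[OF continuous_on_neg_x_ln_x continuous_on_phi1])
          (use phi1_nonneg phi1_le_1 in auto)
      then show "bounded ((\<lambda>t. phi1 t * - ln (phi1 t)) ` {-1..1})"
        by (rule compact_imp_bounded)
      show "bounded (phi1 ` {-1..1})"
        by (intro compact_imp_bounded compact_continuous_image continuous_on_phi1) auto
    qed
    then have D: "(D \<longlongrightarrow> integral {-1..1} (\<lambda>t. (phi1 t * - ln (phi1 t)) * phi1 t)) (at_right 1)"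
      unfolding D_def
    proof (rule tendsto_integral_uniform_limit)
      show "\<forall>\<^sub>F p in at_right 1. continuous_on {-1..1} (\<lambda>t. (v p t - v p t powr p) / (p - 1) * phi1 t)"
        using ev by eventually_elim (intro continuous_intros ns; simp)
    qed (simp add: trivial_limit_at_right_real)
    \<comment> \<open>\<open>D p / A p\<close> tends to \<open>c_tilde\<close>. The weighted
      identity divided by \<open>(p - 1) * A p\<close> equates \<open>pi^2 / 4 * (D p / A p)\<close>
      with \<open>(lam p - pi^2 / 4) / (p - 1)\<close>; near 1 the divisor is nonzero because
      \<open>A\<close> has a positive limit.\<close>
    have "((\<lambda>p. pi\<^sup>2 / 4 * (D p / A p) - pi\<^sup>2 / 4 * c_tilde) \<longlongrightarrow> pi\<^sup>2 / 4 * c_tilde - pi\<^sup>2 / 4 * c_tilde) (at_right 1)"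
      unfolding c_tilde_eq using phi1_integrals_pos(1) by (intro tendsto_intros A D) auto
    moreover have "\<forall>\<^sub>F p in at_right 1. pi\<^sup>2 / 4 * (D p / A p) - pi\<^sup>2 / 4 * c_tilde
        = (lam p - (pi\<^sup>2 / 4 + pi\<^sup>2 / 4 * c_tilde * (p - 1))) / (p - 1)"
      using ev order_tendstoD(1)[OF A phi1_integrals_pos(1)]
    proof eventually_elim
      case (elim p)
      have "D p = integral {-1..1} (\<lambda>t. (v p t - v p t powr p) * phi1 t) / (p - 1)"
        by (simp add: D_def flip: integral_divide)
      then have "(lam p - pi\<^sup>2 / 4) * A p = pi\<^sup>2 / 4 * (D p * (p - 1))"
        using identity[of p] elim by (simp add: A_def)
      then have *: "pi\<^sup>2 / 4 * (D p / A p) = (lam p - pi\<^sup>2 / 4) / (p - 1)"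
        using elim by (simp add: field_simps)
      have eq: "(x - (a + b * e)) / e = (x - a) / e - b" if "e \<noteq> 0" for x a b e :: real
        using that by (simp add: field_simps)
      show ?case
        unfolding * by (rule eq[symmetric]) (use elim in simp)
    qed
    ultimately show "((\<lambda>p. (lam p - (pi\<^sup>2 / 4 + pi\<^sup>2 / 4 * c_tilde * (p - 1))) / (p - 1)) \<longlongrightarrow> 0) (at_right 1)"
      by (simp add: tendsto_cong)
    show "\<forall>\<^sub>F p in at_right 1. p - 1 \<noteq> (0::real)"
      using ev by eventually_elim simp
  qed

  \<comment> \<open>Convergence of the normalized solutions together with their derivatives\<close>
  have part2: "C1_limit {-1..1} v phi1 (at_right 1)"
    unfolding C1_limit_def
  proof (intro exI conjI)
    show "\<forall>\<^sub>F p in at_right 1. C1_deriv_on {-1..1} (v p) (v' p)"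
      using eventually_at_right_1 unfolding C1_deriv_on_def
      by eventually_elim (use ns in blast)
    show "C1_deriv_on {-1..1} phi1 (\<lambda>t. - (pi / 2 * sin (pi / 2 * t)))"
      unfolding C1_deriv_on_def
      by (intro conjI ballI phi1_has_real_derivative continuous_intros)
  qed (fact lim_v lim_v')+

  \<comment> \<open>Local convergence of the potential and of its derivative\<close>
  define q' where "q' = (\<lambda>p t. p * lam p * ((p - 1) * v p t powr (p - 2) * v' p t))"
  have part3: "C1_loc_limit {-1<..<1} (\<lambda>p t. p * u p t powr (p - 1)) (\<lambda>t. pi\<^sup>2 / 4) (at_right 1)"
    unfolding C1_loc_limit_def
  proof (intro exI conjI allI impI; (elim conjE)?)
    show "\<forall>\<^sub>F p in at_right 1. C1_deriv_on {-1<..<1} (\<lambda>t. p * u p t powr (p - 1)) (q' p)"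
      using eventually_at_right_1
    proof eventually_elim
      case (elim p)
      have cont: "continuous_on {-1<..<1} (v p)" "continuous_on {-1<..<1} (v' p)"
        using elim by (auto intro: continuous_on_subset[OF ns(5)] continuous_on_subset[OF ns(6)])
      have "((\<lambda>t. p * u p t powr (p - 1)) has_real_derivative q' p t) (at t within {-1<..<1})"
        if t: "t \<in> {-1<..<1}" for t
      proof (rule has_field_derivative_transform_within[OF _ zero_less_one t])
        have "(v p has_real_derivative v' p t) (at t)"
          using ns(4)[of p t] elim t by (simp add: at_within_Icc_at)
        then have "((\<lambda>t. v p t powr (p - 1)) has_real_derivative
            (p - 1) * v p t powr (p - 1 - of_nat 1) * v' p t) (at t)"
          using ns(3)[of p t] elim t by (intro DERIV_fun_powr) auto
        then have "((\<lambda>t. p * lam p * v p t powr (p - 1)) has_real_derivative q' p t) (at t)"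
          unfolding q'_def by (intro DERIV_cmult) simp
        then show "((\<lambda>t. p * lam p * v p t powr (p - 1)) has_real_derivative q' p t)
            (at t within {-1<..<1})"
          by (rule has_field_derivative_at_within)
      qed (use potential elim in auto)
      moreover have "continuous_on {-1<..<1} (q' p)"
        unfolding q'_def
      proof (intro continuous_intros cont ballI)
        fix t :: real assume "t \<in> {-1<..<1}"
        then show "v p t \<noteq> 0"
          using ns(3)[of p t] elim by simp
      qed
      ultimately show ?case
        unfolding C1_deriv_on_def by blast
    qed
    show "C1_deriv_on {-1<..<1} (\<lambda>t. pi\<^sup>2 / 4) (\<lambda>t. 0)"
      by (simp add: C1_deriv_on_def)
    fix K' :: "real set" assume K': "compact K'" "K' \<subseteq> {-1<..<1}"
    \<comment> \<open>\<open>2 * d\<close> is a lower bound of \<open>phi1\<close> on the compact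
      set, so \<open>v p \<ge> d\<close> there as soon as \<open>K * (p - 1) < d\<close>. This
      distance from 0 is what restricts the convergence to compact subsets of the open
      interval.\<close>
    have "\<exists>d. 0 < d \<and> d \<le> 1 \<and> (\<forall>t\<in>K'. 2 * d \<le> phi1 t)"
    proof (cases "K' = {}")
      case False
      then obtain s where "s \<in> K'" "\<And>t. t \<in> K' \<Longrightarrow> phi1 s \<le> phi1 t"
        using continuous_attains_inf[OF K'(1) _ continuous_on_phi1] by blast
      then show ?thesis
        using phi1_pos[of s] phi1_le_1[of s] K' by (intro exI[of _ "phi1 s / 2"]) auto
    qed (auto intro: exI[of _ 1])
    then obtain d where d: "0 < d" "d \<le> 1" "\<And>t. t \<in> K' \<Longrightarrow> 2 * d \<le> phi1 t"
      by blast
    have ev: "\<forall>\<^sub>F p in at_right 1. 1 < p \<and> p \<le> 2 \<and> (\<forall>t\<in>K'. d \<le> v p t)"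
      using eventually_at_right_1 order_tendstoD(2)[OF tendsto_minus_1_at_right[of K] d(1)]
    proof eventually_elim
      case (elim p)
      have "d \<le> v p t" if "t \<in> K'" for t
        using approx(1)[of p t] d(3)[OF that] elim K' that by (auto simp: abs_le_iff)
      with elim show ?case by blast
    qed
    show "uniform_limit K' (\<lambda>p t. p * u p t powr (p - 1)) (\<lambda>t. pi\<^sup>2 / 4) (at_right 1)"
    proof (rule uniform_limit_real_bound)
      \<comment> \<open>The potential is \<open>p * lam p\<close> minus
        \<open>p * lam p * (1 - v p t powr (p - 1))\<close>, and \<open>v p t powr (p - 1)\<close>
        lies between \<open>d powr (p - 1)\<close>, which tends to 1, and 1.\<close>
      show "\<forall>\<^sub>F p in at_right 1. \<forall>t\<in>K'. \<bar>p * u p t powr (p - 1) - pi\<^sup>2 / 4\<bar>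
          \<le> \<bar>p * lam p - pi\<^sup>2 / 4\<bar> + p * lam p * (1 - d powr (p - 1))"
        using ev
      proof (eventually_elim, intro ballI)
        fix p t assume p: "1 < p \<and> p \<le> 2 \<and> (\<forall>t\<in>K'. d \<le> v p t)" and t: "t \<in> K'"
        then have t': "t \<in> {-1..1}" using K' by auto
        have "d powr (p - 1) \<le> v p t powr (p - 1)" "v p t powr (p - 1) \<le> 1"
          using p t d ns(2)[of p t] t' powr_mono2[of "p - 1" "v p t" 1] ns(1)[of p t]
          by (auto intro!: powr_mono2)
        then have "p * lam p * (1 - v p t powr (p - 1)) \<le> p * lam p * (1 - d powr (p - 1))"
          "0 \<le> p * lam p * (1 - v p t powr (p - 1))"
          using p ns(8)[of p] by (auto intro!: mult_left_mono)
        moreover have "p * u p t powr (p - 1) = p * lam p - p * lam p * (1 - v p t powr (p - 1))"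
          using potential[of p t] p t' by (simp add: algebra_simps)
        ultimately show "\<bar>p * u p t powr (p - 1) - pi\<^sup>2 / 4\<bar>
            \<le> \<bar>p * lam p - pi\<^sup>2 / 4\<bar> + p * lam p * (1 - d powr (p - 1))"
          by linarith
      qed
      have "((\<lambda>p. \<bar>p * lam p - pi\<^sup>2 / 4\<bar> + p * lam p * (1 - d powr (p - 1)))
          \<longlongrightarrow> \<bar>pi\<^sup>2 / 4 - pi\<^sup>2 / 4\<bar> + pi\<^sup>2 / 4 * (1 - d powr (1 - 1))) (at_right 1)"
        using d by (intro tendsto_intros lim_plam lim_p) auto
      then show "((\<lambda>p. \<bar>p * lam p - pi\<^sup>2 / 4\<bar> + p * lam p * (1 - d powr (p - 1))) \<longlongrightarrow> 0) (at_right 1)"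
        using d by simp
    qed
    show "uniform_limit K' q' (\<lambda>t. 0) (at_right 1)"
    proof (rule uniform_limit_real_bound)
      show "\<forall>\<^sub>F p in at_right 1. \<forall>t\<in>K'. \<bar>q' p t - 0\<bar> \<le> p * lam p * ((p - 1) * (1 / d) * (2 + K))"
        using ev
      proof (eventually_elim, intro ballI)
        fix p t assume p: "1 < p \<and> p \<le> 2 \<and> (\<forall>t\<in>K'. d \<le> v p t)" and t: "t \<in> K'"
        then have t': "t \<in> {-1..1}" using K' by auto
        have dv: "d \<le> v p t" "v p t \<le> 1"
          using p t t' ns(2)[of p t] by auto
        \<comment> \<open>The exponent lies in (-1, 0], so the power can exceed 1, but on the
          compact set it stays below \<open>1 / d\<close>. The factor \<open>p - 1\<close> in
          \<open>q'\<close> then forces the limit 0.\<close>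
        have "v p t powr (p - 2) \<le> v p t powr (-1)"
          using p dv d by (intro powr_mono') auto
        also have "\<dots> = 1 / v p t"
          using dv d by (simp add: powr_minus_divide)
        also have "\<dots> \<le> 1 / d"
          using dv d by (intro divide_left_mono) auto
        finally have 1: "v p t powr (p - 2) \<le> 1 / d" .
        have "\<bar>pi / 2 * sin (pi / 2 * t)\<bar> \<le> 2 * 1"
          unfolding abs_mult using pi_less_4 by (intro mult_mono) auto
        moreover have "K * (p - 1) \<le> K * 1"
          using p K by (intro mult_left_mono) auto
        ultimately have 2: "\<bar>v' p t\<bar> \<le> 2 + K"
          using approx(2)[of p t] p t' by auto
        have "\<bar>q' p t\<bar> = p * lam p * ((p - 1) * v p t powr (p - 2) * \<bar>v' p t\<bar>)"
          using p ns(8)[of p] by (simp add: q'_def abs_mult)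
        also have "\<dots> \<le> p * lam p * ((p - 1) * (1 / d) * (2 + K))"
          using p ns(8)[of p] 1 2 d K by (intro mult_left_mono mult_mono) auto
        finally show "\<bar>q' p t - 0\<bar> \<le> p * lam p * ((p - 1) * (1 / d) * (2 + K))"
          by simp
      qed
      have "((\<lambda>p. p * lam p * ((p - 1) * (1 / d) * (2 + K))) \<longlongrightarrow>
          pi\<^sup>2 / 4 * ((1 - 1) * (1 / d) * (2 + K))) (at_right 1)"
        by (intro tendsto_intros lim_plam lim_p)
      then show "((\<lambda>p. p * lam p * ((p - 1) * (1 / d) * (2 + K))) \<longlongrightarrow> 0) (at_right 1)"
        by simp
    qed
  qed

  \<comment> \<open>The first eigenvalue, squeezed between two bounds that tend to 0\<close>
  have part4: "(\<alpha>\<^sub>1 \<longlongrightarrow> 0) (at_right 1)"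
  proof (rule tendsto_sandwich)
    show "((\<lambda>p. pi\<^sup>2 / 4 - p * lam p) \<longlongrightarrow> 0) (at_right 1)"
      using tendsto_diff[OF tendsto_const lim_plam, of "pi\<^sup>2 / 4"] by simp
    show "((\<lambda>p. 0) \<longlongrightarrow> (0::real)) (at_right (1::real))"
      by simp
    show "\<forall>\<^sub>F p in at_right 1. pi\<^sup>2 / 4 - p * lam p \<le> \<alpha>\<^sub>1 p"
      using eventually_at_right_1
    proof eventually_elim
      case (elim p)
      show ?case
      proof (rule dirichlet_eigenvalue_ge)
        show "dirichlet_eigenvalue (\<lambda>t. p * u p t powr (p - 1)) (\<alpha>\<^sub>1 p)"
          using \<alpha>\<^sub>1[of p] elim by (simp add: first_dirichlet_eigenvalue_def)
        fix t :: real assume t: "t \<in> {-1<..<1}"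
        have "v p t powr (p - 1) \<le> 1"
          using ns(1,2)[of p t] elim t powr_mono2[of "p - 1" "v p t" 1] by auto
        then have "p * lam p * v p t powr (p - 1) \<le> p * lam p * 1"
          using elim ns(8)[of p] by (intro mult_left_mono) auto
        then show "p * u p t powr (p - 1) \<le> p * lam p"
          using potential[of p t] elim t by simp
      qed
    qed
    \<comment> \<open>The eigenvalue obtained by shooting is at most 0, and by minimality the first
      eigenvalue does not exceed it.\<close>
    show "\<forall>\<^sub>F p in at_right 1. \<alpha>\<^sub>1 p \<le> 0"
      using eventually_at_right_1
    proof eventually_elim
      case (elim p)
      then obtain \<mu> where \<mu>: "\<mu> \<le> 0" "dirichlet_eigenvalue (\<lambda>t. p * lam p * v p t powr (p - 1)) \<mu>"
        using eigenvalue[of p] by blast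
      then have "dirichlet_eigenvalue (\<lambda>t. p * u p t powr (p - 1)) \<mu>"
        using potential[of p] elim
        by (subst dirichlet_eigenvalue_cong[where q' = "\<lambda>t. p * lam p * v p t powr (p - 1)"]) auto
      then show ?case
        using \<alpha>\<^sub>1[of p] elim \<mu>(1) by (auto simp: first_dirichlet_eigenvalue_def intro: order_trans)
    qed
  qed
  show ?thesis
    using part1 part2 part3 part4 c_tilde_pos unfolding lam_def v_def by blast
qed

end
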